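(* Consider the deterministic ZZ network with non-negative integer channel gains $m_{11}, m_{12}, m_{22}$ (first stage) and $n_{11}, n_{12}, n_{22}$ (second stage), the gains $m_{21}$ and $n_{21}$ being zero. The capacity region (admissible rate region) of this network is the set of all pairs $(r_1,r_2)$ of non-negative real numbers which satisfy $$r_1 \le m_{11},$$ $$r_2 \le m_{22},$$ $$r_1 \le n_{11},$$ $$r_2 \le n_{22},$$ $$r_1 + r_2 \le \max(m_{11}, m_{12}) + (m_{22}-m_{12})^+ + n_{12},$$ $$r_1 + r_2 \le \max(n_{11}, n_{12}) + (n_{22}-n_{12})^+ + m_{12}.$$
   Context: Notation: $(x)^+ = \max(x,0)$. All signal arithmetic is over the binary field $\mathbb{F}_2$. Two-stage deterministic network. There are two sources $S_1,S_2$, two relays $R_1,R_2$ and two destinations $D_1,D_2$. Let $m_{ij}$ (gain from $S_j$ to $R_i$) and $n_{ij}$ (gain from $R_j$ to $D_i$), $i,j\in\{1,2\}$, be non-negative integers, and let $q\ge 1$ be an integer at least as large as all of them. Let $J$ be the $q\times q$ shift matrix over $\mathbb{F}_2$ with ones exactly on the first subdiagonal (entry $(k+1,k)$ equal to $1$ for $1\le k\le q-1$) and zeros elsewhere, with $J^0=I$. Put $M_{ij}=J^{q-m_{ij}}$ and $N_{ij}=J^{q-n_{ij}}$ (so a link of gain $0$ has the zero matrix). At each time instant, if the sources send $X_1,X_2\in\mathbb{F}_2^q$, the relays receive $$Y_1' = M_{11}X_1+M_{12}X_2,\qquad Y_2' = M_{21}X_1+M_{22}X_2,$$ and if the relays send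 $X_1',X_2'\in\mathbb{F}_2^q$, the destinations receive $$Y_1 = N_{11}X_1'+N_{12}X_2',\qquad Y_2 = N_{21}X_1'+N_{22}X_2'.$$ Only the relays hear the sources, and only the destinations hear the relays. ZZ network: the case $m_{21}=0$ (no link from $S_1$ to $R_2$) and $n_{21}=0$ (no link from $R_1$ to $D_2$). Codes. Sources $S_1, S_2$ have independent messages $W_1,W_2$, uniformly distributed on finite sets $\mathcal{W}_1,\mathcal{W}_2$. A code of block length $n$ consists of: source encoders $\mathcal{W}_i\to(\mathbb{F}_2^q)^n$, $W_i\mapsto X_i^n$ ($i=1,2$), used over a block of $n$ time instants; relay maps $(\mathbb{F}_2^q)^n\to(\mathbb{F}_2^q)^n$, $Y_i'^n\mapsto X_i'^n$ ($i=1,2$), each relay waiting for the whole received block and then sending the resulting vectors in the next block of $n$ time instants; and decoders $(\mathbb{F}_2^q)^n\to\mathcal{W}_i$, $Y_i^n\mapsto\hat W_i$ ($i=1,2$), where $D_i$ is only required to decode $W_i$. The error probability is $\Pr[(\hat W_1,\hat W_2)\neq(W_1,W_2)]$. Admissible rates. A pair $(r_1,r_2)$ of non-negative reals is admissible if for every $\varepsilon>0$ and all sufficiently large $n$ there is a code of block length $n$ with $|\mathcal{W}_i|\ge 2^{n(r_i-\varepsilon)}$ for $i=1,2$ and error probability at most $\varepsilon$. The admissible rate region (capacity region) is the set of all admissible pairs. *)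

theory Defs
  imports
    "HOL-Probability.Probability_Mass_Function"
    "HOL-Library.Z2"
    "Jordan_Normal_Form.Matrix"
begin

hide_type (open) Finite_Cartesian_Product.vec
hide_const (open) Finite_Cartesian_Product.vec Finite_Cartesian_Product.mat
no_notation Finite_Cartesian_Product.vec_nth (infixl "$" 90)

text \<open>
  Everywhere below, nodes within a layer are indexed by 1 and 2. A gain table
  \<open>g\<close> gives the integer gain \<open>g i j\<close> of the link from transmitter \<open>j\<close> to receiver \<open>i\<close>.
\<close>

definition shift_mat :: "nat \<Rightarrow> bit mat" where
  "shift_mat q = mat q q (\<lambda>(i, j). if i = Suc j then 1 else 0)"

definition link_mat :: "nat \<Rightarrow> nat \<Rightarrow> bit mat" where
  "link_mat q g = shift_mat q ^\<^sub>m (q - g)"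

definition received :: "nat \<Rightarrow> (nat \<Rightarrow> nat \<Rightarrow> nat) \<Rightarrow> nat \<Rightarrow> bit vec \<Rightarrow> bit vec \<Rightarrow> bit vec" where
  "received q g i x1 x2 = link_mat q (g i 1) *\<^sub>v x1 + link_mat q (g i 2) *\<^sub>v x2"

definition received_block ::
  "nat \<Rightarrow> (nat \<Rightarrow> nat \<Rightarrow> nat) \<Rightarrow> nat \<Rightarrow> bit vec list \<Rightarrow> bit vec list \<Rightarrow> bit vec list" where
  "received_block q g i xs1 xs2 = map2 (received q g i) xs1 xs2"

definition blocks :: "nat \<Rightarrow> nat \<Rightarrow> bit vec list set" where
  "blocks q len = {xs. length xs = len \<and> set xs \<subseteq> carrier_vec q}"

text \<open>Message sets are finite sets of naturals, which covers all finite sets up to renaming.\<close>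

record relay_code =
  messages :: "nat \<Rightarrow> nat set"
  encoder :: "nat \<Rightarrow> nat \<Rightarrow> bit vec list"
  relay :: "nat \<Rightarrow> bit vec list \<Rightarrow> bit vec list"
  decoder :: "nat \<Rightarrow> bit vec list \<Rightarrow> nat"

definition is_code :: "nat \<Rightarrow> nat \<Rightarrow> relay_code \<Rightarrow> bool" where
  "is_code q len C \<longleftrightarrow> (\<forall>i\<in>{1, 2}.
     finite (messages C i) \<and> messages C i \<noteq> {} \<and>
     encoder C i \<in> messages C i \<rightarrow> blocks q len \<and>
     relay C i \<in> blocks q len \<rightarrow> blocks q len \<and>
     decoder C i \<in> blocks q len \<rightarrow> messages C i)"

definition relay_input ::
  "nat \<Rightarrow> (nat \<Rightarrow> nat \<Rightarrow> nat) \<Rightarrow> relay_code \<Rightarrow> nat \<times> nat \<Rightarrow> nat \<Rightarrow> bit vec list" where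
  "relay_input q m C w i =
     received_block q m i (encoder C 1 (fst w)) (encoder C 2 (snd w))"

definition destination_input ::
  "nat \<Rightarrow> (nat \<Rightarrow> nat \<Rightarrow> nat) \<Rightarrow> (nat \<Rightarrow> nat \<Rightarrow> nat) \<Rightarrow> relay_code \<Rightarrow> nat \<times> nat \<Rightarrow> nat \<Rightarrow> bit vec list"
  where
  "destination_input q m n C w i =
     received_block q n i
       (relay C 1 (relay_input q m C w 1)) (relay C 2 (relay_input q m C w 2))"

definition decoded ::
  "nat \<Rightarrow> (nat \<Rightarrow> nat \<Rightarrow> nat) \<Rightarrow> (nat \<Rightarrow> nat \<Rightarrow> nat) \<Rightarrow> relay_code \<Rightarrow> nat \<times> nat \<Rightarrow> nat \<times> nat" where
  "decoded q m n C w =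
     (decoder C 1 (destination_input q m n C w 1), decoder C 2 (destination_input q m n C w 2))"

definition error_prob ::
  "nat \<Rightarrow> (nat \<Rightarrow> nat \<Rightarrow> nat) \<Rightarrow> (nat \<Rightarrow> nat \<Rightarrow> nat) \<Rightarrow> relay_code \<Rightarrow> real" where
  "error_prob q m n C =
     measure_pmf.prob (pair_pmf (pmf_of_set (messages C 1)) (pmf_of_set (messages C 2)))
       {w. decoded q m n C w \<noteq> w}"

definition admissible ::
  "nat \<Rightarrow> (nat \<Rightarrow> nat \<Rightarrow> nat) \<Rightarrow> (nat \<Rightarrow> nat \<Rightarrow> nat) \<Rightarrow> real \<Rightarrow> real \<Rightarrow> bool" where
  "admissible q m n r1 r2 \<longleftrightarrow> 0 \<le> r1 \<and> 0 \<le> r2 \<and>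
     (\<forall>\<epsilon>>0. \<forall>\<^sub>F len in sequentially. \<exists>C. is_code q len C \<and>
        real (card (messages C 1)) \<ge> 2 powr (real len * (r1 - \<epsilon>)) \<and>
        real (card (messages C 2)) \<ge> 2 powr (real len * (r2 - \<epsilon>)) \<and>
        error_prob q m n C \<le> \<epsilon>)"

definition capacity_region ::
  "nat \<Rightarrow> (nat \<Rightarrow> nat \<Rightarrow> nat) \<Rightarrow> (nat \<Rightarrow> nat \<Rightarrow> nat) \<Rightarrow> (real \<times> real) set" where
  "capacity_region q m n = {(r1, r2). admissible q m n r1 r2}"

end

theory Submission imports Defs begin

text \<open>Converse: if the decoders are right, a genie-aided receiver recovers the messages. For the
  first sum bound, \<open>Y\<^sub>1'\<close> together with \<open>N\<^sub>1\<^sub>2 X\<^sub>2'\<close> yields \<open>W\<^sub>1\<close>, hence \<open>X\<^sub>1\<close>, hence \<open>M\<^sub>1\<^sub>2 X\<^sub>2\<close>; the levels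
  of \<open>X\<^sub>2\<close> below \<open>m\<^sub>1\<^sub>2\<close> then yield \<open>W\<^sub>2\<close>. The second one exchanges the stages. Since the channel is
  deterministic, the bounds follow by counting the correctly decoded message pairs.

  Achievability: every integer point of the region is reached by a single-use code without errors.
  Message bit \<open>i\<close> of the first source is aligned with bit \<open>i\<close> of the second one for \<open>i < v\<close> in the first
  stage and for \<open>i < v'\<close> in the second stage. The first relay forwards the sum of the two bits for
  \<open>i < max v v'\<close> and the plain bit of the first source otherwise; for \<open>i < v'\<close> the second relay's signal
  neutralizes the interference over the air. Time sharing between
  the two corners of the dominant face gives the rest of the region.\<close>

section \<open>Entries of the signals received over shift links\<close>

lemma shift_mat_pow:
  "shift_mat q ^\<^sub>m d = mat q q (\<lambda>(i, j). if i = j + d then 1 else 0)"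
proof (induction d)
  case 0
  show ?case by (rule eq_matI) (auto simp: shift_mat_def)
next
  case (Suc d)
  have dim: "dim_row (shift_mat q) = q" "dim_col (shift_mat q) = q"
    by (simp_all add: shift_mat_def)
  have "row (shift_mat q ^\<^sub>m d) i \<bullet> col (shift_mat q) j = (if i = j + Suc d then 1 else 0)"
    if "i < q" "j < q" for i j
  proof -
    have "row (shift_mat q ^\<^sub>m d) i \<bullet> col (shift_mat q) j =
        (\<Sum>l\<in>{0..<q}. if l = Suc j then (if i = j + Suc d then 1 else 0) else 0)"
      unfolding scalar_prod_def Suc using that
      by (auto simp: shift_mat_def intro!: sum.cong)
    then show ?thesis using that by (simp add: sum.delta)
  qed
  then show ?case
    by (intro eq_matI) (auto simp: dim)
qed

text \<open>For \<open>g \<le> q\<close> the shift by \<open>q - g\<close> moves the top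
  \<open>g\<close> entries of \<open>x\<close> to the bottom \<open>g\<close> rows and pushes all
  others out of the vector.\<close>

lemma link_mat_mult_vec:
  assumes "x \<in> carrier_vec q" "k < q"
  shows "(link_mat q g *\<^sub>v x) $ k = (if q - g \<le> k then x $ (k - (q - g)) else 0)"
proof -
  have "(link_mat q g *\<^sub>v x) $ k = (\<Sum>j\<in>{0..<q}. if k = j + (q - g) then x $ j else 0)"
  proof -
    have dim: "dim_row (link_mat q g) = q" "dim_vec x = q"
      using assms by (simp_all add: link_mat_def shift_mat_pow)
    have "row (link_mat q g) k = vec q (\<lambda>j. if k = j + (q - g) then 1 else 0)"
      using assms by (intro eq_vecI) (simp_all add: link_mat_def shift_mat_pow)
    then have "(link_mat q g *\<^sub>v x) $ k = vec q (\<lambda>j. if k = j + (q - g) then 1 else 0) \<bullet> x"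
      using dim assms(2) by simp
    also have "\<dots> = (\<Sum>j\<in>{0..<q}. if k = j + (q - g) then x $ j else 0)"
      unfolding scalar_prod_def dim(2) by (rule sum.cong) (simp_all del: mult_bit_eq_and)
    finally show ?thesis .
  qed
  also have "\<dots> = (\<Sum>j\<in>{0..<q}. if j = k - (q - g) then (if q - g \<le> k then x $ j else 0) else 0)"
    by (intro sum.cong) auto
  finally show ?thesis using assms by (simp add: sum.delta)
qed

lemma received_carrier [simp]: "received q g i x1 x2 \<in> carrier_vec q"
  by (simp add: received_def link_mat_def shift_mat_pow carrier_dim_vec)

lemma received_entry:
  assumes "x1 \<in> carrier_vec q" "x2 \<in> carrier_vec q" "k < q"
  shows "received q g i x1 x2 $ k =
    (if q - g i 1 \<le> k then x1 $ (k - (q - g i 1)) else 0) +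
    (if q - g i 2 \<le> k then x2 $ (k - (q - g i 2)) else 0)"
proof -
  have "dim_vec (link_mat q (g i 2) *\<^sub>v x2) = q"
    by (simp add: link_mat_def shift_mat_pow)
  then show ?thesis
    using assms unfolding received_def by (simp add: link_mat_mult_vec del: index_mult_mat_vec)
qed

lemma blocks_nth: "xs \<in> blocks q len \<Longrightarrow> t < len \<Longrightarrow> xs ! t \<in> carrier_vec q"
  unfolding blocks_def by (blast intro: nth_mem)

lemma blocks_length: "xs \<in> blocks q len \<Longrightarrow> length xs = len"
  by (simp add: blocks_def)

lemma received_block_in_blocks:
  assumes "xs1 \<in> blocks q len" "xs2 \<in> blocks q len"
  shows "received_block q g i xs1 xs2 \<in> blocks q len"
  using assms by (force simp: blocks_def received_block_def)

lemma received_block_entry: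
  assumes "xs1 \<in> blocks q len" "xs2 \<in> blocks q len" "t < len" "k < q"
  shows "(received_block q g i xs1 xs2 ! t) $ k =
    (if q - g i 1 \<le> k then (xs1 ! t) $ (k - (q - g i 1)) else 0) +
    (if q - g i 2 \<le> k then (xs2 ! t) $ (k - (q - g i 2)) else 0)"
proof -
  have "length xs1 = len" "length xs2 = len"
    using assms(1,2) by (simp_all add: blocks_length)
  then have "received_block q g i xs1 xs2 ! t = received q g i (xs1 ! t) (xs2 ! t)"
    using assms(3) by (simp add: received_block_def)
  then show ?thesis
    using received_entry[OF blocks_nth[OF assms(1,3)] blocks_nth[OF assms(2,3)] assms(4)] by simp
qed

lemma received_block_append:
  assumes "length xs1 = length xs2"
  shows "received_block q g i (xs1 @ ys1) (xs2 @ ys2) =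
    received_block q g i xs1 xs2 @ received_block q g i ys1 ys2"
  using assms by (simp add: received_block_def)

lemma blocks_eqI:
  assumes "xs \<in> blocks q len" "ys \<in> blocks q len"
    and "\<And>t k. t < len \<Longrightarrow> k < q \<Longrightarrow> (xs ! t) $ k = (ys ! t) $ k"
  shows "xs = ys"
proof (rule nth_equalityI)
  show "length xs = length ys" using assms by (simp add: blocks_def)
next
  fix t assume "t < length xs"
  with assms(1) have t: "t < len" by (simp add: blocks_length)
  have "dim_vec (xs ! t) = q" "dim_vec (ys ! t) = q"
    using blocks_nth[OF assms(1) t] blocks_nth[OF assms(2) t] by simp_all
  with assms(3)[OF t] show "xs ! t = ys ! t" by (intro eq_vecI) simp_all
qed

section \<open>Placing message bits on signal levels in one stage\<close>

text \<open>Unoccupied levels carry \<open>0\<close>, so they do not disturb the levels with which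
  they coincide at a receiver. The inverse of \<open>pos\<close> is reliable only for
  \<open>pos\<close> injective on \<open>{..<r}\<close>, which \<open>place_at\<close>
  assumes.\<close>

definition place :: "nat \<Rightarrow> (nat \<Rightarrow> nat) \<Rightarrow> nat \<Rightarrow> (nat \<Rightarrow> bit) \<Rightarrow> bit vec" where
  "place q pos r w =
    vec q (\<lambda>k. if k \<in> pos ` {..<r} then w (the_inv_into {..<r} pos k) else 0)"

lemma place_carrier [simp]: "place q pos r w \<in> carrier_vec q"
  by (simp add: place_def)

lemma place_at:
  assumes "inj_on pos {..<r}" "i < r" "pos i < q"
  shows "place q pos r w $ (pos i) = w i"
  using assms by (simp add: place_def the_inv_into_f_f)

lemma place_off: "k < q \<Longrightarrow> k \<notin> pos ` {..<r} \<Longrightarrow> place q pos r w $ k = 0"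
  by (simp add: place_def)

text \<open>Positions count from the top of the transmitted vector. At the first receiver position
  \<open>a\<close> of the first transmitter has height \<open>p - a\<close> above the noise floor, position \<open>b\<close> of the
  second one has height \<open>s - b\<close>. The second transmitter fills its \<open>z\<close> top positions and, below
  position \<open>s\<close>, positions that the first receiver does not hear.\<close>

lemma level_assignment:
  fixes p s t r1 r2 z :: nat
  assumes "r1 \<le> p" "r2 \<le> t" "z \<le> s" "z \<le> r2" "r2 - z \<le> t - s"
  defines "v \<equiv> r1 + z - max p s"
  obtains \<alpha> \<beta> :: "nat \<Rightarrow> nat"
  where "inj_on \<alpha> {..<r1}" "\<And>i. i < r1 \<Longrightarrow> \<alpha> i < p"
    "inj_on \<beta> {..<r2}" "\<And>j. j < r2 \<Longrightarrow> \<beta> j < t"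
    "\<And>j. j < z \<Longrightarrow> \<beta> j < s" "\<And>j. z \<le> j \<Longrightarrow> s \<le> \<beta> j"
    "\<And>i. i < v \<Longrightarrow> p + \<beta> i = s + \<alpha> i"
    "\<And>i j. i < r1 \<Longrightarrow> j < z \<Longrightarrow> p + \<beta> j = s + \<alpha> i \<Longrightarrow> i = j \<and> i < v"
proof -
  \<comment> \<open>\<open>h i\<close> is the height of bit \<open>i\<close> of the first
    transmitter at the first receiver. There the audible bits of the second transmitter occupy the
    heights \<open>s - z + 1\<close> to \<open>s\<close>. The first \<open>v\<close> bits overlap
    this range from its bottom; the others fill the heights \<open>1\<close> to \<open>s - z\<close>
    and continue above \<open>s\<close>.\<close>
  define h where "h i = (if i < v then s - z + 1 + i
    else if i - v < s - z then i - v + 1 else i - v + 1 + z)" for i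
  \<comment> \<open>The audible bits are stored in reverse order, so that bit \<open>j\<close> gets
    height \<open>s - (z - 1 - j) = s - z + 1 + j\<close>, the same as \<open>h j\<close> for
    \<open>j < v\<close>.\<close>
  define \<beta> where "\<beta> j = (if j < z then z - 1 - j else s + (j - z))" for j
  have v: "v \<le> z" "v \<le> r1" "0 < v \<Longrightarrow> s - z + v \<le> p"
    "r1 + z \<le> max p s + v"
    using assms(1-5) by (auto simp: v_def)
  have h: "1 \<le> h i \<and> h i \<le> p" if "i < r1" for i
  proof (cases "p \<le> s")
    case True
    with that v(4) assms(1,3) show ?thesis using v(3) by (auto simp: h_def)
  next
    case False
    with that v(4) assms(1,3) show ?thesis using v(3) by (auto simp: h_def)
  qed
  have h_low: "h i = s - z + 1 + i" if "i < v" for i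
    using that by (simp add: h_def)
  have h_mid: "h i = i - v + 1" if "v \<le> i" "i - v < s - z" for i
    using that by (simp add: h_def)
  have h_high: "h i = i - v + 1 + z" if "v \<le> i" "s - z \<le> i - v" for i
    using that by (simp add: h_def)
  \<comment> \<open>The middle range of \<open>h\<close> stays below the heights in question and the
    upper range above them, so only the first range can meet them.\<close>
  have h_eq: "i = j \<and> i < v" if "h i = s - z + 1 + j" "j < z" for i j
  proof -
    consider "i < v" | "v \<le> i" "i - v < s - z" | "v \<le> i" "s - z \<le> i - v" by linarith
    then show ?thesis using that h_low[of i] h_mid[of i] h_high[of i] assms(3) by cases linarith+
  qed
  have h_inj: "i = j" if "h i = h j" for i j
  proof -
    consider "i < v" | "j < v" | "v \<le> i" "v \<le> j" by linarith
    then show ?thesis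
    proof cases
      case 1
      then show ?thesis using h_eq[of j i] h_low[of i] that v(1) by simp
    next
      case 2
      then show ?thesis using h_eq[of i j] h_low[of j] that v(1) by simp
    next
      case 3
      then show ?thesis
        using h_mid[of i] h_high[of i] h_mid[of j] h_high[of j] that by linarith
    qed
  qed
  have "inj_on (\<lambda>i. p - h i) {..<r1}"
  proof (rule inj_onI)
    fix i j assume "i \<in> {..<r1}" "j \<in> {..<r1}" "p - h i = p - h j"
    then have "h i = h j" by (metis h diff_diff_cancel lessThan_iff)
    then show "i = j" by (rule h_inj)
  qed
  moreover have "p - h i < p" if "i < r1" for i
    using h[OF that] by auto
  moreover have "inj_on \<beta> {..<r2}"
    using assms(3) by (auto simp: \<beta>_def inj_on_def split: if_splits)
  moreover have "\<beta> j < t" if "j < r2" for j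
    using that assms(2-5) by (auto simp: \<beta>_def)
  moreover have "\<beta> j < s" if "j < z" for j
    using that assms(3) by (auto simp: \<beta>_def)
  moreover have "s \<le> \<beta> j" if "z \<le> j" for j
    using that by (auto simp: \<beta>_def)
  moreover have "p + \<beta> i = s + (p - h i)" if "i < v" for i
    using that v(1,2) h[of i] h_low[of i] assms(3) by (simp add: \<beta>_def)
  moreover have "i = j \<and> i < v" if "i < r1" "j < z" "p + \<beta> j = s + (p - h i)" for i j
    using that h[of i] assms(3) by (intro h_eq) (auto simp: \<beta>_def)
  ultimately show ?thesis by - (rule that[of "\<lambda>i. p - h i" \<beta>], blast+)
qed

text \<open>Of the \<open>r2\<close> bits of the second transmitter the first receiver hears the first \<open>z\<close>, and exactly
  the first \<open>v\<close> of these collide with bits of the first transmitter.\<close>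

definition transmits where
  "transmits q g v r1 r2 z enc1 enc2 \<rho> \<sigma> \<tau> \<longleftrightarrow>
     (\<forall>w. enc1 w \<in> carrier_vec q \<and> enc2 w \<in> carrier_vec q) \<and>
     (\<forall>w1 w2.
       (\<forall>i<v. received q g 1 (enc1 w1) (enc2 w2) $ \<rho> i = w1 i + w2 i) \<and>
       (\<forall>i. v \<le> i \<and> i < r1 \<longrightarrow> received q g 1 (enc1 w1) (enc2 w2) $ \<rho> i = w1 i) \<and>
       (\<forall>j. v \<le> j \<and> j < z \<longrightarrow> received q g 1 (enc1 w1) (enc2 w2) $ \<sigma> j = w2 j) \<and>
       (\<forall>j<r2. received q g 2 (enc1 w1) (enc2 w2) $ \<tau> j = w2 j))"

text \<open>Bits are placed by \<open>level_assignment\<close>; \<open>\<rho>\<close>,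
  \<open>\<sigma>\<close> and \<open>\<tau>\<close> are the rows in which these levels arrive, the
  shift being added to the transmitted position. Since \<open>g 2 1 = 0\<close>, the second receiver
  hears every bit of the second transmitter without interference.\<close>

lemma one_stage_transmission:
  fixes q r1 r2 z :: nat and g :: "nat \<Rightarrow> nat \<Rightarrow> nat"
  assumes "g 1 1 \<le> q" "g 1 2 \<le> q" "g 2 2 \<le> q" "g 2 1 = 0"
    and "r1 \<le> g 1 1" "r2 \<le> g 2 2" "z \<le> g 1 2" "z \<le> r2" "r2 - z \<le> g 2 2 - g 1 2"
  defines "v \<equiv> r1 + z - max (g 1 1) (g 1 2)"
  obtains enc1 enc2 :: "(nat \<Rightarrow> bit) \<Rightarrow> bit vec" and \<rho> \<sigma> \<tau> :: "nat \<Rightarrow> nat"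
  where "transmits q g v r1 r2 z enc1 enc2 \<rho> \<sigma> \<tau>"
proof (rule level_assignment[OF assms(5-9), folded v_def])
  fix \<alpha> \<beta> :: "nat \<Rightarrow> nat"
  assume \<alpha>: "inj_on \<alpha> {..<r1}" "\<And>i. i < r1 \<Longrightarrow> \<alpha> i < g 1 1"
    and \<beta>: "inj_on \<beta> {..<r2}" "\<And>j. j < r2 \<Longrightarrow> \<beta> j < g 2 2"
      "\<And>j. j < z \<Longrightarrow> \<beta> j < g 1 2" "\<And>j. z \<le> j \<Longrightarrow> g 1 2 \<le> \<beta> j"
    and aligned: "\<And>i. i < v \<Longrightarrow> g 1 1 + \<beta> i = g 1 2 + \<alpha> i"
    and clean: "\<And>i j. i < r1 \<Longrightarrow> j < z \<Longrightarrow> g 1 1 + \<beta> j = g 1 2 + \<alpha> i \<Longrightarrow> i = j \<and> i < v"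
  have v: "v \<le> z" "v \<le> r1" using assms by (auto simp: v_def)
  define enc1 where "enc1 = place q \<alpha> r1"
  define enc2 where "enc2 = place q \<beta> r2"
  have enc1_at: "enc1 w $ \<alpha> i = w i" if "i < r1" for w i
    unfolding enc1_def by (rule place_at) (use \<alpha>(1) \<alpha>(2)[OF that] assms(1) that in auto)
  have enc2_at: "enc2 w $ \<beta> j = w j" if "j < r2" for w j
    unfolding enc2_def by (rule place_at) (use \<beta>(1) \<beta>(2)[OF that] assms(3) that in auto)
  have c: "enc1 w \<in> carrier_vec q" "enc2 w \<in> carrier_vec q" for w
    by (simp_all add: enc1_def enc2_def)
  define \<rho> where "\<rho> i = q - g 1 1 + \<alpha> i" for i
  define \<sigma> where "\<sigma> j = q - g 1 2 + \<beta> j" for j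
  define \<tau> where "\<tau> j = q - g 2 2 + \<beta> j" for j
  show ?thesis
  proof (rule that[of enc1 enc2 \<rho> \<sigma> \<tau>], unfold transmits_def, intro conjI allI impI; (elim conjE)?)
    show "enc1 w \<in> carrier_vec q" "enc2 w \<in> carrier_vec q" for w by (fact c)+
  next
    fix w1 w2 i assume "i < v"
    with v assms(8) have i: "i < r1" "i < r2" by auto
    have "q - g 1 2 + \<beta> i = \<rho> i"
      using aligned[OF \<open>i < v\<close>] assms(1,2) by (simp add: \<rho>_def)
    then have "q - g 1 2 \<le> \<rho> i" "\<rho> i - (q - g 1 2) = \<beta> i" by auto
    moreover have "\<rho> i < q" "q - g 1 1 \<le> \<rho> i" "\<rho> i - (q - g 1 1) = \<alpha> i"
      using \<alpha>(2)[OF i(1)] assms(1) by (auto simp: \<rho>_def)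
    \<comment> \<open>\<open>add_bit_eq_xor\<close> would turn the sum into an exclusive or;
      removing it keeps the field form of \<open>transmits\<close>.\<close>
    ultimately show "received q g 1 (enc1 w1) (enc2 w2) $ \<rho> i = w1 i + w2 i"
      using i by (simp add: received_entry c enc1_at enc2_at del: add_bit_eq_xor)
  next
    fix w1 w2 i assume "v \<le> i" and i: "i < r1"
    have \<rho>: "\<rho> i < q" "q - g 1 1 \<le> \<rho> i" "\<rho> i - (q - g 1 1) = \<alpha> i"
      using \<alpha>(2)[OF i] assms(1) by (auto simp: \<rho>_def)
    \<comment> \<open>A bit of the second transmitter found here would lie above the noise floor of
      the first receiver, hence have index \<open>j < z\<close>; \<open>clean\<close> admits such a
      coincidence only for \<open>i < v\<close>.\<close>
    have "enc2 w2 $ (\<rho> i - (q - g 1 2)) = 0" if le: "q - g 1 2 \<le> \<rho> i"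
      unfolding enc2_def
    proof (rule place_off)
      show "\<rho> i - (q - g 1 2) < q" using \<rho>(1) by simp
      show "\<rho> i - (q - g 1 2) \<notin> \<beta> ` {..<r2}"
      proof
        assume "\<rho> i - (q - g 1 2) \<in> \<beta> ` {..<r2}"
        then obtain j where j: "\<rho> i - (q - g 1 2) = \<beta> j" by auto
        then have "\<beta> j < g 1 2" using \<rho>(1) assms(2) le by linarith
        then have "j < z" using \<beta>(4)[of j] by force
        moreover have "g 1 1 + \<beta> j = g 1 2 + \<alpha> i"
          using j le assms(1,2) by (simp add: \<rho>_def)
        ultimately show False using clean[OF i] \<open>v \<le> i\<close> by fastforce
      qed
    qed
    with i \<rho> show "received q g 1 (enc1 w1) (enc2 w2) $ \<rho> i = w1 i"
      by (simp add: received_entry c enc1_at)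
  next
    fix w1 w2 j assume "v \<le> j" "j < z"
    then have j: "j < r2" "\<beta> j < g 1 2" using assms(8) \<beta>(3) by auto
    have \<sigma>: "\<sigma> j < q" "q - g 1 2 \<le> \<sigma> j" "\<sigma> j - (q - g 1 2) = \<beta> j"
      using j assms(2) by (auto simp: \<sigma>_def)
    have "enc1 w1 $ (\<sigma> j - (q - g 1 1)) = 0" if le: "q - g 1 1 \<le> \<sigma> j"
      unfolding enc1_def
    proof (rule place_off)
      show "\<sigma> j - (q - g 1 1) < q" using \<sigma>(1) by simp
      show "\<sigma> j - (q - g 1 1) \<notin> \<alpha> ` {..<r1}"
      proof
        assume "\<sigma> j - (q - g 1 1) \<in> \<alpha> ` {..<r1}"
        then obtain i where i: "\<sigma> j - (q - g 1 1) = \<alpha> i" "i < r1" by auto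
        have "g 1 1 + \<beta> j = g 1 2 + \<alpha> i"
          using i le assms(1,2) by (simp add: \<sigma>_def)
        then show False using clean[OF i(2) \<open>j < z\<close>] \<open>v \<le> j\<close> by simp
      qed
    qed
    with j \<sigma> show "received q g 1 (enc1 w1) (enc2 w2) $ \<sigma> j = w2 j"
      by (simp add: received_entry c enc2_at)
  next
    fix w1 w2 j assume j: "j < r2"
    have "\<tau> j < q" "q - g 2 2 \<le> \<tau> j" "\<tau> j - (q - g 2 2) = \<beta> j"
      using \<beta>(2)[OF j] assms(3) by (auto simp: \<tau>_def)
    with j assms(4) show "received q g 2 (enc1 w1) (enc2 w2) $ \<tau> j = w2 j"
      by (simp add: received_entry c enc2_at)
  qed
qed

section \<open>Codes without errors and their concatenation\<close>

definition nat_of_bits :: "nat \<Rightarrow> (nat \<Rightarrow> bit) \<Rightarrow> nat" where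
  "nat_of_bits r f = horner_sum of_bool 2 (map (\<lambda>i. f i = 1) [0..<r])"

lemma nat_of_bits_less: "nat_of_bits r f < 2 ^ r"
  using horner_sum_of_bool_2_less[of "map (\<lambda>i. f i = 1) [0..<r]"]
  by (simp add: nat_of_bits_def)

lemma nat_of_bits_eq:
  assumes "a < 2 ^ r" "\<And>i. i < r \<Longrightarrow> f i = of_bool (bit a i)"
  shows "nat_of_bits r f = a"
proof (rule bit_eqI)
  fix i
  have "bit a i \<Longrightarrow> i < r"
    using assms(1) by (metis bit_take_bit_iff take_bit_nat_eq_self_iff)
  then show "bit (nat_of_bits r f) i = bit a i"
    using assms(2)[of i] by (auto simp: nat_of_bits_def bit_horner_sum_bit_iff)
qed

text \<open>Messages are initial segments of the naturals, so that products of message sets regain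
  this form by division with remainder. The relays and decoders are constrained on all blocks, as
  \<open>is_code\<close> demands.\<close>

definition zero_error_scheme where
  "zero_error_scheme q m n len (A :: nat) (B :: nat) e1 e2 f1 f2 d1 d2 \<longleftrightarrow> 0 < A \<and> 0 < B \<and>
     (\<forall>a<A. e1 a \<in> blocks q len) \<and> (\<forall>b<B. e2 b \<in> blocks q len) \<and>
     (\<forall>ys\<in>blocks q len. f1 ys \<in> blocks q len \<and> f2 ys \<in> blocks q len \<and>
       d1 ys < A \<and> d2 ys < B) \<and>
     (\<forall>a<A. \<forall>b<B.
       let xs1 = f1 (received_block q m 1 (e1 a) (e2 b));
           xs2 = f2 (received_block q m 2 (e1 a) (e2 b))
       in d1 (received_block q n 1 xs1 xs2) = a \<and> d2 (received_block q n 2 xs1 xs2) = b)"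

definition zero_error_code ::
  "nat \<Rightarrow> (nat \<Rightarrow> nat \<Rightarrow> nat) \<Rightarrow> (nat \<Rightarrow> nat \<Rightarrow> nat) \<Rightarrow> nat \<Rightarrow> nat \<Rightarrow> nat \<Rightarrow> bool" where
  "zero_error_code q m n len A B \<longleftrightarrow>
     (\<exists>e1 e2 f1 f2 d1 d2. zero_error_scheme q m n len A B e1 e2 f1 f2 d1 d2)"

lemma zero_error_code_relay_code:
  assumes "zero_error_code q m n len A B"
  obtains C where "is_code q len C" "card (messages C 1) = A" "card (messages C 2) = B"
    "error_prob q m n C = 0"
proof -
  obtain e1 e2 f1 f2 d1 d2 where S: "zero_error_scheme q m n len A B e1 e2 f1 f2 d1 d2"
    using assms by (auto simp: zero_error_code_def)
  define C where "C = \<lparr>messages = (\<lambda>i. if i = 1 then {..<A} else {..<B}),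
    encoder = (\<lambda>i. if i = 1 then e1 else e2), relay = (\<lambda>i. if i = 1 then f1 else f2),
    decoder = (\<lambda>i. if i = 1 then d1 else d2)\<rparr>"
  have AB: "0 < A" "0 < B" using S by (auto simp: zero_error_scheme_def)
  have msg: "messages C 1 = {..<A}" "messages C 2 = {..<B}"
    by (simp_all add: C_def)
  have "is_code q len C"
    using S by (auto simp: C_def is_code_def zero_error_scheme_def lessThan_empty_iff)
  moreover have "decoded q m n C (a, b) = (a, b)" if "a < A" "b < B" for a b
    using S that
    by (simp add: C_def zero_error_scheme_def Let_def decoded_def destination_input_def relay_input_def)
  then have "error_prob q m n C = 0"
    using AB unfolding error_prob_def msg
    by (subst measure_pmf_zero_iff) (auto simp: lessThan_empty_iff)
  ultimately show ?thesis using that msg by simp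
qed

text \<open>The channel acts on every time instant separately, so two codes can run one after the
  other. A message of the joint code is split into its remainder for the first code and its quotient
  for the second.\<close>

lemma zero_error_code_append:
  assumes "zero_error_code q m n len A B" "zero_error_code q m n len' A' B'"
  shows "zero_error_code q m n (len + len') (A * A') (B * B')"
proof -
  obtain e1 e2 f1 f2 d1 d2 where S: "zero_error_scheme q m n len A B e1 e2 f1 f2 d1 d2"
    using assms(1) by (auto simp: zero_error_code_def)
  obtain e1' e2' f1' f2' d1' d2' where
    S': "zero_error_scheme q m n len' A' B' e1' e2' f1' f2' d1' d2'"
    using assms(2) by (auto simp: zero_error_code_def)
  have append: "xs @ ys \<in> blocks q (len + len')"
    if "xs \<in> blocks q len" "ys \<in> blocks q len'" for xs ys
    using that by (simp add: blocks_def)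
  have take: "take len ys \<in> blocks q len" and drop: "drop len ys \<in> blocks q len'"
    if "ys \<in> blocks q (len + len')" for ys
    using that set_take_subset[of len ys] set_drop_subset[of len ys]
    by (simp_all add: blocks_def subset_trans)
  have split: "a mod X < X" "a div X < X'" if "a < X * X'" "0 < X" for a X X' :: nat
    using that by (simp_all add: less_mult_imp_div_less mult.commute)
  have join: "a + X * a' < X * X'" if "a < X" "a' < X'" for a a' X X' :: nat
  proof -
    have "a + X * a' < X * Suc a'" using that by simp
    also have "\<dots> \<le> X * X'" using that by (intro mult_le_mono2) simp
    finally show ?thesis .
  qed
  define E1 where "E1 a = e1 (a mod A) @ e1' (a div A)" for a
  define E2 where "E2 b = e2 (b mod B) @ e2' (b div B)" for b
  define F1 where "F1 ys = f1 (take len ys) @ f1' (drop len ys)" for ys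
  define F2 where "F2 ys = f2 (take len ys) @ f2' (drop len ys)" for ys
  define D1 where "D1 ys = d1 (take len ys) + A * d1' (drop len ys)" for ys
  define D2 where "D2 ys = d2 (take len ys) + B * d2' (drop len ys)" for ys
  have pos: "0 < A" "0 < B" "0 < A'" "0 < B'"
    using S S' by (auto simp: zero_error_scheme_def)
  have enc: "e1 a \<in> blocks q len" if "a < A" for a
    using S that by (simp add: zero_error_scheme_def)
  have enc2: "e2 b \<in> blocks q len" if "b < B" for b
    using S that by (simp add: zero_error_scheme_def)
  have enc': "e1' a \<in> blocks q len'" if "a < A'" for a
    using S' that by (simp add: zero_error_scheme_def)
  have enc2': "e2' b \<in> blocks q len'" if "b < B'" for b
    using S' that by (simp add: zero_error_scheme_def)
  have maps: "f1 ys \<in> blocks q len" "f2 ys \<in> blocks q len" "d1 ys < A" "d2 ys < B"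
    if "ys \<in> blocks q len" for ys
    using S that by (simp_all add: zero_error_scheme_def)
  have maps': "f1' ys \<in> blocks q len'" "f2' ys \<in> blocks q len'" "d1' ys < A'" "d2' ys < B'"
    if "ys \<in> blocks q len'" for ys
    using S' that by (simp_all add: zero_error_scheme_def)
  have dec: "D1 (received_block q n 1 (F1 (received_block q m 1 (E1 a) (E2 b)))
        (F2 (received_block q m 2 (E1 a) (E2 b)))) = a"
      "D2 (received_block q n 2 (F1 (received_block q m 1 (E1 a) (E2 b)))
        (F2 (received_block q m 2 (E1 a) (E2 b)))) = b"
    if ab: "a < A * A'" "b < B * B'" for a b
  proof -
    define x1 x2 x1' x2' where "x1 = e1 (a mod A)" and "x2 = e2 (b mod B)"
      and "x1' = e1' (a div A)" and "x2' = e2' (b div B)"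
    note x_def = x1_def x2_def x1'_def x2'_def
    have x: "x1 \<in> blocks q len" "x2 \<in> blocks q len" "x1' \<in> blocks q len'" "x2' \<in> blocks q len'"
      unfolding x_def using split[OF ab(1) pos(1)] split[OF ab(2) pos(2)] enc enc2 enc' enc2' by auto
    define y1 y2 y1' y2' where "y1 = f1 (received_block q m 1 x1 x2)"
      and "y2 = f2 (received_block q m 2 x1 x2)"
      and "y1' = f1' (received_block q m 1 x1' x2')"
      and "y2' = f2' (received_block q m 2 x1' x2')"
    note y_def = y1_def y2_def y1'_def y2'_def
    have y: "y1 \<in> blocks q len" "y2 \<in> blocks q len" "y1' \<in> blocks q len'" "y2' \<in> blocks q len'"
      unfolding y_def by (intro maps maps' received_block_in_blocks x)+
    have rec: "received_block q g i (xs @ xs') (ys @ ys') =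
        received_block q g i xs ys @ received_block q g i xs' ys'"
        "length (received_block q g i xs ys) = len"
      if "xs \<in> blocks q len" "ys \<in> blocks q len" for g i xs ys xs' ys'
      using that received_block_in_blocks[OF that, of g i]
      by (simp_all add: blocks_length received_block_append)
    have F: "F1 (received_block q m 1 (E1 a) (E2 b)) = y1 @ y1'"
        "F2 (received_block q m 2 (E1 a) (E2 b)) = y2 @ y2'"
      by (simp_all add: F1_def F2_def E1_def E2_def rec[OF x(1,2)] y_def flip: x_def)
    have d: "d1 (received_block q n 1 y1 y2) = a mod A" "d2 (received_block q n 2 y1 y2) = b mod B"
      using S split(1)[OF ab(1) pos(1)] split(1)[OF ab(2) pos(2)]
      by (simp_all add: zero_error_scheme_def Let_def y_def x_def)
    have d': "d1' (received_block q n 1 y1' y2') = a div A"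
        "d2' (received_block q n 2 y1' y2') = b div B"
      using S' split(2)[OF ab(1) pos(1)] split(2)[OF ab(2) pos(2)]
      by (simp_all add: zero_error_scheme_def Let_def y_def x_def)
    show "D1 (received_block q n 1 (F1 (received_block q m 1 (E1 a) (E2 b)))
        (F2 (received_block q m 2 (E1 a) (E2 b)))) = a"
      "D2 (received_block q n 2 (F1 (received_block q m 1 (E1 a) (E2 b)))
        (F2 (received_block q m 2 (E1 a) (E2 b)))) = b"
      unfolding F D1_def D2_def using d d' by (simp_all add: rec[OF y(1,2)])
  qed
  have "zero_error_scheme q m n (len + len') (A * A') (B * B') E1 E2 F1 F2 D1 D2"
    unfolding zero_error_scheme_def Let_def
  proof (intro conjI allI impI ballI)
    show "0 < A * A'" "0 < B * B'" using pos by simp_all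
  next
    fix a assume "a < A * A'"
    then show "E1 a \<in> blocks q (len + len')"
      unfolding E1_def using split[of a A A'] pos by (intro append enc enc') auto
  next
    fix b assume "b < B * B'"
    then show "E2 b \<in> blocks q (len + len')"
      unfolding E2_def using split[of b B B'] pos by (intro append enc2 enc2') auto
  next
    fix ys assume ys: "ys \<in> blocks q (len + len')"
    show "F1 ys \<in> blocks q (len + len')" "F2 ys \<in> blocks q (len + len')"
      unfolding F1_def F2_def by (intro append maps maps' take drop ys)+
    show "D1 ys < A * A'" "D2 ys < B * B'"
      unfolding D1_def D2_def by (intro join maps maps' take drop ys)+
  qed (use dec in auto)
  then show ?thesis unfolding zero_error_code_def by blast
qed

lemma zero_error_code_empty: "zero_error_code q m n 0 1 1"
proof -
  have "zero_error_scheme q m n 0 1 1 (\<lambda>_. []) (\<lambda>_. []) (\<lambda>_. []) (\<lambda>_. []) (\<lambda>_. 0) (\<lambda>_. 0)"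
    by (simp add: zero_error_scheme_def blocks_def)
  then show ?thesis unfolding zero_error_code_def by blast
qed

lemma zero_error_code_power:
  assumes "zero_error_code q m n 1 A B"
  shows "zero_error_code q m n k (A ^ k) (B ^ k)"
proof (induction k)
  case 0
  show ?case using zero_error_code_empty by simp
next
  case (Suc k)
  with zero_error_code_append[OF assms Suc.IH] show ?case by simp
qed

section \<open>Single-use codes for the integer points\<close>

text \<open>The last two conditions make the two stages compatible: a bit of the second source that
  collides in one stage must be heard by the first receiver of the other stage.\<close>

lemma visible_bit_counts:
  fixes p s t p' s' t' r1 r2 :: nat
  assumes "r1 \<le> p" "r1 \<le> p'" "r2 \<le> t" "r2 \<le> t'"
    and "r1 + r2 \<le> max p s + (t - s) + s'" "r1 + r2 \<le> max p' s' + (t' - s') + s"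
  obtains z z' where "z \<le> s" "z \<le> r2" "r2 - z \<le> t - s"
    "z' \<le> s'" "z' \<le> r2" "r2 - z' \<le> t' - s'"
    "r1 + z - max p s \<le> z'" "r1 + z' - max p' s' \<le> z"
proof -
  define h h' P P' where "h = t - s" and "h' = t' - s'" and "P = max p s" and "P' = max p' s'"
  \<comment> \<open>The requirements within each stage say exactly that \<open>z\<close> lies
    between \<open>a\<close> and \<open>b\<close>, and \<open>z'\<close> between \<open>a'\<close>
    and \<open>b'\<close>.\<close>
  define a a' b b' where "a = r2 - h" and "a' = r2 - h'" and "b = min r2 s" and "b' = min r2 s'"
  have r1: "r1 \<le> P" "r1 \<le> P'" using assms(1,2) by (auto simp: P_def P'_def)
  have a: "a \<le> s" "a \<le> r2" "r2 \<le> h + a" "a' \<le> s'" "a' \<le> r2" "r2 \<le> h' + a'"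
    using assms(3,4) by (auto simp: a_def a'_def h_def h'_def)
  have b: "b \<le> s" "b \<le> r2" "r2 \<le> h + b" "b' \<le> s'" "b' \<le> r2" "r2 \<le> h' + b'"
    using assms(3,4) by (auto simp: b_def b'_def h_def h'_def)
  \<comment> \<open>The sum bounds enter here: they give the first compatibility condition at
    \<open>z = a\<close>, \<open>z' = b'\<close> and the second one at \<open>z = b\<close>,
    \<open>z' = a'\<close>.\<close>
  have u: "r1 + a \<le> b' + P" "r1 + a' \<le> b + P'"
  proof -
    have "r1 + r2 \<le> P + h + s'" "r1 + r2 \<le> P' + h' + s"
      using assms(5,6) by (simp_all add: P_def P'_def h_def h'_def)
    then show "r1 + a \<le> b' + P" "r1 + a' \<le> b + P'"
      using r1 a(2,5) unfolding a_def a'_def b_def b'_def min_def by (simp_all, linarith+)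
  qed
  note thesis_rule = that
  have thesisI: thesis
    if cond: "z \<le> s" "z \<le> r2" "r2 \<le> h + z" "z' \<le> s'" "z' \<le> r2" "r2 \<le> h' + z'"
      "r1 + z \<le> z' + P" "r1 + z' \<le> z + P'" for z z'
    by (rule thesis_rule[of z z'])
      (use cond in \<open>simp_all add: h_def h'_def P_def P'_def le_diff_conv add.commute\<close>)
  have "a \<le> b" "a' \<le> b'" using a by (simp_all add: b_def b'_def)
  \<comment> \<open>If the two intervals meet, a common value serves for both stages, as
    \<open>r1 \<le> P\<close> and \<open>r1 \<le> P'\<close>. If they are disjoint, their facing
    endpoints do: one condition follows from their order, the other from \<open>u\<close>.\<close>
  consider "max a a' \<le> min b b'" | "b < a'" | "b' < a"
    using \<open>a \<le> b\<close> \<open>a' \<le> b'\<close> by linarith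
  then show ?thesis
  proof cases
    case 1
    define z where "z = max a a'"
    have "a \<le> z" "a' \<le> z" "z \<le> b" "z \<le> b'" using 1 by (simp_all add: z_def)
    with r1 a b show ?thesis by (intro thesisI[of z z]) simp_all
  next
    case 2
    with r1 a b u show ?thesis by (intro thesisI[of b a']) simp_all
  next
    case 3
    with r1 a b u show ?thesis by (intro thesisI[of a b']) simp_all
  qed
qed

text \<open>Both stages use \<open>one_stage_transmission\<close>, with \<open>z\<close> and
  \<open>z'\<close> from \<open>visible_bit_counts\<close>. Over the binary field a second copy of
  an interfering bit removes the first, so wherever the collisions of the two stages do not match,
  the first relay or the first destination supplies the missing copy.\<close>

lemma single_use_code:
  assumes gains: "\<forall>i\<in>{1, 2}. \<forall>j\<in>{1, 2}. m i j \<le> q \<and> n i j \<le> q"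
    and "m 2 1 = 0" "n 2 1 = 0"
    and "r1 \<le> m 1 1" "r1 \<le> n 1 1" "r2 \<le> m 2 2" "r2 \<le> n 2 2"
    and "r1 + r2 \<le> max (m 1 1) (m 1 2) + (m 2 2 - m 1 2) + n 1 2"
    and "r1 + r2 \<le> max (n 1 1) (n 1 2) + (n 2 2 - n 1 2) + m 1 2"
  shows "zero_error_code q m n 1 (2 ^ r1) (2 ^ r2)"
proof -
  obtain z z' where z: "z \<le> m 1 2" "z \<le> r2" "r2 - z \<le> m 2 2 - m 1 2"
    and z': "z' \<le> n 1 2" "z' \<le> r2" "r2 - z' \<le> n 2 2 - n 1 2"
    and cross: "r1 + z - max (m 1 1) (m 1 2) \<le> z'" "r1 + z' - max (n 1 1) (n 1 2) \<le> z"
    by (rule visible_bit_counts[OF assms(4,5,6,7,8,9)])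
  have gm: "m 1 1 \<le> q" "m 1 2 \<le> q" "m 2 2 \<le> q" and gn: "n 1 1 \<le> q" "n 1 2 \<le> q" "n 2 2 \<le> q"
    using gains by auto
  define v where "v = r1 + z - max (m 1 1) (m 1 2)"
  define v' where "v' = r1 + z' - max (n 1 1) (n 1 2)"
  obtain enc1 enc2 \<rho> \<sigma> \<tau> where T: "transmits q m v r1 r2 z enc1 enc2 \<rho> \<sigma> \<tau>"
    by (rule one_stage_transmission[OF gm assms(2,4,6) z, folded v_def])
  have E: "\<And>w. enc1 w \<in> carrier_vec q" "\<And>w. enc2 w \<in> carrier_vec q"
    and Y: "\<And>w1 w2 i. i < v \<Longrightarrow> received q m 1 (enc1 w1) (enc2 w2) $ \<rho> i = w1 i + w2 i"
      "\<And>w1 w2 i. v \<le> i \<Longrightarrow> i < r1 \<Longrightarrow> received q m 1 (enc1 w1) (enc2 w2) $ \<rho> i = w1 i"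
      "\<And>w1 w2 j. v \<le> j \<Longrightarrow> j < z \<Longrightarrow> received q m 1 (enc1 w1) (enc2 w2) $ \<sigma> j = w2 j"
      "\<And>w1 w2 j. j < r2 \<Longrightarrow> received q m 2 (enc1 w1) (enc2 w2) $ \<tau> j = w2 j"
    using T unfolding transmits_def by blast+
  obtain enc1' enc2' \<rho>' \<sigma>' \<tau>' where T': "transmits q n v' r1 r2 z' enc1' enc2' \<rho>' \<sigma>' \<tau>'"
    by (rule one_stage_transmission[OF gn assms(3,5,7) z', folded v'_def])
  have E': "\<And>w. enc1' w \<in> carrier_vec q" "\<And>w. enc2' w \<in> carrier_vec q"
    and Y': "\<And>w1 w2 i. i < v' \<Longrightarrow> received q n 1 (enc1' w1) (enc2' w2) $ \<rho>' i = w1 i + w2 i"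
      "\<And>w1 w2 i. v' \<le> i \<Longrightarrow> i < r1 \<Longrightarrow> received q n 1 (enc1' w1) (enc2' w2) $ \<rho>' i = w1 i"
      "\<And>w1 w2 j. v' \<le> j \<Longrightarrow> j < z' \<Longrightarrow> received q n 1 (enc1' w1) (enc2' w2) $ \<sigma>' j = w2 j"
      "\<And>w1 w2 j. j < r2 \<Longrightarrow> received q n 2 (enc1' w1) (enc2' w2) $ \<tau>' j = w2 j"
    using T' unfolding transmits_def by blast+
  \<comment> \<open>For \<open>v \<le> i < v'\<close> the bit arrives clean, but the second stage
    will add the interfering bit. The relay adds it in advance; \<open>v' \<le> z\<close> ensures
    that it is heard at \<open>\<sigma> i\<close>.\<close>
  define relay1 where "relay1 y =
    enc1' (\<lambda>i. y $ \<rho> i + (if v \<le> i \<and> i < v' then y $ \<sigma> i else 0))" for y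
  define relay2 where "relay2 y = enc2' (\<lambda>j. y $ \<tau> j)" for y
  \<comment> \<open>For \<open>v' \<le> i < v\<close> the relayed sum meets no neutralizing signal.
    The interfering bit is then heard separately at \<open>\<sigma>' i\<close>, because
    \<open>v \<le> z'\<close>, and is removed by the destination.\<close>
  define dest1 where "dest1 y =
    nat_of_bits r1 (\<lambda>i. y $ \<rho>' i + (if v' \<le> i \<and> i < v then y $ \<sigma>' i else 0))" for y
  define dest2 where "dest2 y = nat_of_bits r2 (\<lambda>j. y $ \<tau>' j)" for y
  define bits where "bits a i = (of_bool (bit a i) :: bit)" for a i :: nat
  have double: "x + x = 0" for x :: bit by (cases x) simp_all
  have dest: "dest1 (received q n 1 x1 x2) = a" "dest2 (received q n 2 x1 x2) = b"
    if ab: "a < 2 ^ r1" "b < 2 ^ r2"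
      and x1: "x1 = relay1 (received q m 1 (enc1 (bits a)) (enc2 (bits b)))"
      and x2: "x2 = relay2 (received q m 2 (enc1 (bits a)) (enc2 (bits b)))" for a b x1 x2
  proof -
    let ?y1 = "received q m 1 (enc1 (bits a)) (enc2 (bits b))"
    let ?y2 = "received q m 2 (enc1 (bits a)) (enc2 (bits b))"
    define c where "c i = ?y1 $ \<rho> i + (if v \<le> i \<and> i < v' then ?y1 $ \<sigma> i else 0)" for i
    define d where "d j = ?y2 $ \<tau> j" for j
    have x: "x1 = enc1' c" "x2 = enc2' d"
      unfolding x1 x2 relay1_def relay2_def c_def d_def by simp_all
    have c: "c i = bits a i + (if i < max v v' then bits b i else 0)" if "i < r1" for i
      using that cross(2)[folded v'_def] Y(1)[of i] Y(2)[of i] Y(3)[of i]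
      by (cases "i < v") (auto simp: c_def simp del: add_bit_eq_xor)
    have d: "d j = bits b j" if "j < r2" for j
      unfolding d_def by (rule Y(4)[OF that])
    show "dest2 (received q n 2 x1 x2) = b"
      unfolding dest2_def x by (rule nat_of_bits_eq[OF ab(2)]) (simp add: Y'(4) d flip: bits_def)
    show "dest1 (received q n 1 x1 x2) = a"
      unfolding dest1_def x
    proof (rule nat_of_bits_eq[OF ab(1)], fold bits_def)
      fix i assume i: "i < r1"
      let ?r = "received q n 1 (enc1' c) (enc2' d)"
      show "?r $ \<rho>' i + (if v' \<le> i \<and> i < v then ?r $ \<sigma>' i else 0) = bits a i"
      proof (cases "i < v'")
        case True
        \<comment> \<open>The second relay knows the bit to be neutralized only for indices below
          \<open>r2\<close>; this follows from \<open>v' \<le> z \<le> r2\<close>.\<close>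
        then have "i < r2" using cross(2)[folded v'_def] z(2) by linarith
        with True i have "?r $ \<rho>' i = bits a i + bits b i + bits b i"
          using Y'(1)[OF True, of c d] c[of i] d[of i] by simp
        with True show ?thesis by (simp add: add.assoc double del: add_bit_eq_xor)
      next
        case False
        then have "?r $ \<rho>' i = bits a i + (if i < v then bits b i else 0)"
          using i Y'(2)[of i c d] c[of i] by (simp add: less_max_iff_disj)
        moreover have "?r $ \<sigma>' i = bits b i" if "i < v"
          using that cross(1)[folded v_def] False z'(2) Y'(3)[of i c d] d[of i] by simp
        ultimately show ?thesis using False
          by (simp add: add.assoc double del: add_bit_eq_xor)
      qed
    qed
  qed
  have single: "ys \<in> blocks q 1 \<Longrightarrow> \<exists>y. ys = [y]" for ys
    by (auto simp: blocks_def length_Suc_conv)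
  have in_blocks: "[y] \<in> blocks q 1 \<longleftrightarrow> y \<in> carrier_vec q" for y
    by (simp add: blocks_def)
  have rec: "received_block q g i [x1] [x2] = [received q g i x1 x2]" for g i x1 x2
    by (simp add: received_block_def)
  have "zero_error_scheme q m n 1 (2 ^ r1) (2 ^ r2)
      (\<lambda>a. [enc1 (bits a)]) (\<lambda>b. [enc2 (bits b)]) (\<lambda>ys. [relay1 (hd ys)]) (\<lambda>ys. [relay2 (hd ys)])
      (\<lambda>ys. dest1 (hd ys)) (\<lambda>ys. dest2 (hd ys))"
    unfolding zero_error_scheme_def in_blocks rec Let_def list.sel
    using E E' dest by (auto simp: relay1_def relay2_def dest1_def dest2_def nat_of_bits_less)
  then show ?thesis unfolding zero_error_code_def by blast
qed

section \<open>Time sharing between the corners\<close>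

text \<open>The first corner is used \<open>k\<close> times and the second one
  \<open>len - k\<close> times. Rounding \<open>k\<close> to an integer costs the first source at
  most \<open>a + b - c\<close> bits, which the slack \<open>\<epsilon> * len\<close>
  absorbs.\<close>

lemma time_sharing_code:
  fixes a b c :: nat and r1 r2 \<epsilon> :: real
  assumes P: "zero_error_code q m n 1 (2 ^ a) (2 ^ (c - a))"
    and Q: "zero_error_code q m n 1 (2 ^ (c - b)) (2 ^ b)"
    and ab: "a \<le> c" "b \<le> c" "c \<le> a + b"
    and r: "r1 \<le> a" "r2 \<le> b" "r1 + r2 \<le> c"
    and "real (a + b - c) \<le> \<epsilon> * len" "0 \<le> \<epsilon>"
  shows "\<exists>x y. zero_error_code q m n len (2 ^ x) (2 ^ y) \<and>
    len * (r1 - \<epsilon>) \<le> x \<and> len * (r2 - \<epsilon>) \<le> y"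
proof -
  define d where "d = a + b - c"
  \<comment> \<open>Replacing one use of the second corner by the first moves \<open>d\<close> bits
    from the second source to the first, so \<open>k\<close> is the largest count that leaves
    \<open>len * r2\<close> bits to the second source. For \<open>d = 0\<close> the quotient is
    \<open>0\<close> by convention, hence \<open>k = 0\<close>.\<close>
  define k where "k = min len (nat \<lfloor>len * (b - r2) / d\<rfloor>)"
  have k: "k \<le> len" by (simp add: k_def)
  have kd: "real k * d \<le> len * (b - r2)"
  proof (cases "d = 0")
    case False
    have "real k \<le> real (nat \<lfloor>len * (b - r2) / d\<rfloor>)" by (simp add: k_def)
    also have "\<dots> \<le> len * (b - r2) / d"
      using r(2) by (simp add: of_nat_nat)
    finally show ?thesis using False by (simp add: field_simps)
  qed (use r(2) in simp)
  have kx: "len * (r1 - \<epsilon>) \<le> real len * (c - b) + real k * d"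
  proof (cases "k = len \<or> d = 0")
    \<comment> \<open>Either only the first corner is used, or \<open>d = 0\<close> and the corners
      coincide.\<close>
    case True
    have "len * (r1 - \<epsilon>) \<le> len * real a"
      using r(1) assms(10) by (intro mult_left_mono) auto
    also have "\<dots> = real len * (c - b) + real k * d"
      using ab True by (auto simp: d_def algebra_simps of_nat_diff)
    finally show ?thesis .
  next
    case False
    then have k_eq: "k = nat \<lfloor>len * (b - r2) / d\<rfloor>" and "0 < d"
      by (auto simp: k_def)
    have "len * (b - r2) / d \<le> real k + 1" unfolding k_eq by linarith
    then have "len * (b - r2) \<le> real k * d + d" using \<open>0 < d\<close> by (simp add: field_simps)
    moreover have "len * r1 \<le> len * (c - r2)" using r(3) by (intro mult_left_mono) auto
    ultimately show ?thesis
      using assms(9) ab by (simp add: d_def[symmetric] algebra_simps of_nat_diff)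
  qed
  define x y where "x = a * k + (c - b) * (len - k)" and "y = (c - a) * k + b * (len - k)"
  have diff: "real (c - b) = real c - real b" "real (c - a) = real c - real a"
      "real (len - k) = real len - real k" "real d = real a + real b - real c"
    using k ab by (simp_all add: d_def of_nat_diff)
  have "zero_error_code q m n (k + (len - k)) ((2 ^ a) ^ k * (2 ^ (c - b)) ^ (len - k))
      ((2 ^ (c - a)) ^ k * (2 ^ b) ^ (len - k))"
    by (intro zero_error_code_append zero_error_code_power P Q)
  then have "zero_error_code q m n len (2 ^ x) (2 ^ y)"
    using k by (simp add: x_def y_def power_add power_mult)
  moreover have "real x = real len * (c - b) + real k * d"
    unfolding x_def of_nat_add of_nat_mult diff by (simp add: algebra_simps)
  moreover have "real y = len * real b - real k * d"
    unfolding y_def of_nat_add of_nat_mult diff by (simp add: algebra_simps)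
  moreover have "len * (r2 - \<epsilon>) \<le> len * r2"
    using assms(10) by (intro mult_left_mono) auto
  ultimately show ?thesis
    using kx kd by (intro exI[of _ x] exI[of _ y]) (simp add: algebra_simps)
qed

lemma admissible_by_time_sharing:
  fixes a b c :: nat and r1 r2 :: real
  assumes "zero_error_code q m n 1 (2 ^ a) (2 ^ (c - a))" "zero_error_code q m n 1 (2 ^ (c - b)) (2 ^ b)"
    and "a \<le> c" "b \<le> c" "c \<le> a + b"
    and "r1 \<le> a" "r2 \<le> b" "r1 + r2 \<le> c" and "0 \<le> r1" "0 \<le> r2"
  shows "admissible q m n r1 r2"
  unfolding admissible_def
proof (intro conjI allI impI assms)
  fix \<epsilon> :: real assume \<epsilon>: "\<epsilon> > 0"
  have "\<exists>C. is_code q len C \<and>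
        real (card (messages C 1)) \<ge> 2 powr (real len * (r1 - \<epsilon>)) \<and>
        real (card (messages C 2)) \<ge> 2 powr (real len * (r2 - \<epsilon>)) \<and>
        error_prob q m n C \<le> \<epsilon>" if "len \<ge> nat \<lceil>real (a + b - c) / \<epsilon>\<rceil>" for len
  proof -
    have "real (a + b - c) / \<epsilon> \<le> len" using that by linarith
    then have "real (a + b - c) \<le> \<epsilon> * len" using \<epsilon> by (simp add: field_simps)
    then obtain x y where xy: "zero_error_code q m n len (2 ^ x) (2 ^ y)"
      "len * (r1 - \<epsilon>) \<le> x" "len * (r2 - \<epsilon>) \<le> y"
      using time_sharing_code[OF assms(1-8)] \<epsilon> by force
    obtain C where "is_code q len C" "card (messages C 1) = 2 ^ x" "card (messages C 2) = 2 ^ y"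
      "error_prob q m n C = 0"
      by (rule zero_error_code_relay_code[OF xy(1)])
    moreover have "2 powr (len * (r1 - \<epsilon>)) \<le> 2 ^ x" "2 powr (len * (r2 - \<epsilon>)) \<le> 2 ^ y"
      using xy(2,3) by (simp_all flip: powr_realpow)
    ultimately show ?thesis using \<epsilon> by auto
  qed
  then show "\<forall>\<^sub>F len in sequentially. \<exists>C. is_code q len C \<and>
        real (card (messages C 1)) \<ge> 2 powr (real len * (r1 - \<epsilon>)) \<and>
        real (card (messages C 2)) \<ge> 2 powr (real len * (r2 - \<epsilon>)) \<and>
        error_prob q m n C \<le> \<epsilon>"
    unfolding eventually_sequentially by blast
qed

text \<open>All bounds are integers, so the ends \<open>(a, c - a)\<close> and
  \<open>(c - b, b)\<close> of the dominant face are integer points and are reached by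
  \<open>single_use_code\<close>.\<close>

lemma achievability:
  fixes r1 r2 :: real
  assumes "\<forall>i\<in>{1, 2}. \<forall>j\<in>{1, 2}. m i j \<le> q \<and> n i j \<le> q"
    and "m 2 1 = 0" "n 2 1 = 0"
    and "0 \<le> r1" "0 \<le> r2" "r1 \<le> m 1 1" "r2 \<le> m 2 2" "r1 \<le> n 1 1" "r2 \<le> n 2 2"
    and "r1 + r2 \<le> real (max (m 1 1) (m 1 2) + (m 2 2 - m 1 2) + n 1 2)"
    and "r1 + r2 \<le> real (max (n 1 1) (n 1 2) + (n 2 2 - n 1 2) + m 1 2)"
  shows "admissible q m n r1 r2"
proof -
  define A where "A = max (m 1 1) (m 1 2) + (m 2 2 - m 1 2) + n 1 2"
  define B where "B = max (n 1 1) (n 1 2) + (n 2 2 - n 1 2) + m 1 2"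
  define a where "a = min (m 1 1) (n 1 1)"
  define b where "b = min (m 2 2) (n 2 2)"
  define c where "c = min (a + b) (min A B)"
  have ab: "a \<le> m 1 1" "a \<le> n 1 1" "b \<le> m 2 2" "b \<le> n 2 2"
    by (simp_all add: a_def b_def)
  have c: "c \<le> a + b" "c \<le> A" "c \<le> B" by (simp_all add: c_def)
  have "a \<le> A" "a \<le> B" "b \<le> A" "b \<le> B" using ab by (auto simp: A_def B_def)
  then have le: "a \<le> c" "b \<le> c" by (auto simp: c_def)
  have code: "zero_error_code q m n 1 (2 ^ x) (2 ^ y)" if "x \<le> a" "y \<le> b" "x + y = c" for x y
    by (rule single_use_code[OF assms(1-3)])
      (use that c[unfolded A_def B_def] ab in simp_all)
  have "zero_error_code q m n 1 (2 ^ a) (2 ^ (c - a))" "zero_error_code q m n 1 (2 ^ (c - b)) (2 ^ b)"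
    by (rule code; use le c in simp)+
  moreover have "r1 \<le> a" "r2 \<le> b"
    using assms(6-9) by (simp_all add: a_def b_def)
  moreover from this have "r1 + r2 \<le> c"
    using assms(10,11) unfolding A_def[symmetric] B_def[symmetric] by (simp add: c_def)
  ultimately show ?thesis
    using le c(1) assms(4,5) by (intro admissible_by_time_sharing[where a = a and b = b and c = c])
qed

section \<open>Counting the correctly decoded message pairs\<close>

lemma pair_pmf_of_set_prod:
  assumes "finite A" "A \<noteq> {}" "finite B" "B \<noteq> {}"
  shows "pair_pmf (pmf_of_set A) (pmf_of_set B) = pmf_of_set (A \<times> B)"
proof (rule pmf_eqI)
  fix w
  show "pmf (pair_pmf (pmf_of_set A) (pmf_of_set B)) w = pmf (pmf_of_set (A \<times> B)) w"
    using assms by (cases w) (simp add: pmf_pair card_cartesian_product indicator_def)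
qed

definition decoded_pairs ::
  "nat \<Rightarrow> (nat \<Rightarrow> nat \<Rightarrow> nat) \<Rightarrow> (nat \<Rightarrow> nat \<Rightarrow> nat) \<Rightarrow> relay_code \<Rightarrow> (nat \<times> nat) set" where
  "decoded_pairs q m n C = {w \<in> messages C 1 \<times> messages C 2. decoded q m n C w = w}"

text \<open>The message pair is uniform, so probabilities are ratios of counts. This lets the
  converse proceed by injections instead of entropies.\<close>

lemma card_decoded_pairs:
  assumes "is_code q len C"
  shows "card (decoded_pairs q m n C) =
    (1 - error_prob q m n C) * (card (messages C 1) * card (messages C 2))"
proof -
  let ?M = "messages C 1 \<times> messages C 2"
  have M: "finite (messages C 1)" "messages C 1 \<noteq> {}" "finite (messages C 2)" "messages C 2 \<noteq> {}"
    using assms by (simp_all add: is_code_def)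
  have "1 - error_prob q m n C = measure_pmf.prob (pmf_of_set ?M) {w. decoded q m n C w = w}"
    unfolding error_prob_def pair_pmf_of_set_prod[OF M]
    by (subst measure_pmf.prob_compl[symmetric]) (auto intro!: arg_cong2[where f = measure])
  also have "\<dots> = card (decoded_pairs q m n C) / card ?M"
    using M by (subst measure_pmf_of_set) (auto simp: decoded_pairs_def Int_def)
  finally show ?thesis
    using M by (simp add: card_cartesian_product)
qed

text \<open>What a link of gain \<open>g \<le> q\<close> delivers depends only on the top
  \<open>g\<close> entries of each vector; \<open>agree\<close> compares blocks as such a link
  does.\<close>

definition agree :: "nat \<Rightarrow> nat \<Rightarrow> bit vec list \<Rightarrow> bit vec list \<Rightarrow> bool" where
  "agree len g xs ys \<longleftrightarrow> (\<forall>t<len. \<forall>i<g. xs ! t $ i = ys ! t $ i)"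

text \<open>The restriction to a finite index set makes the observed entries an element of the
  finite set \<open>patterns len g\<close>, whose size is a power of \<open>2\<close>.\<close>

definition coords :: "nat \<Rightarrow> nat \<Rightarrow> nat \<Rightarrow> bit vec list \<Rightarrow> nat \<times> nat \<Rightarrow> bit" where
  "coords len k g xs = (\<lambda>(t, i)\<in>{..<len} \<times> {..<g}. xs ! t $ (k + i))"

definition patterns :: "nat \<Rightarrow> nat \<Rightarrow> (nat \<times> nat \<Rightarrow> bit) set" where
  "patterns len g = {..<len} \<times> {..<g} \<rightarrow>\<^sub>E UNIV"

lemma coords_in_patterns [simp]: "coords len k g xs \<in> patterns len g"
  by (auto simp: coords_def patterns_def)

lemma UNIV_bit: "(UNIV :: bit set) = {0, 1}"
  by auto

lemma finite_patterns [simp]: "finite (patterns len g)"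
  unfolding patterns_def UNIV_bit by (intro finite_PiE) auto

lemma card_patterns: "card (patterns len g) = 2 ^ (len * g)"
  unfolding patterns_def UNIV_bit by (simp add: card_funcsetE card_cartesian_product numeral_2_eq_2)

lemma coords_eqD:
  assumes "coords len k g xs = coords len k g ys" "t < len" "i < g"
  shows "xs ! t $ (k + i) = ys ! t $ (k + i)"
  using fun_cong[OF assms(1), of "(t, i)"] assms(2,3) by (simp add: coords_def)

lemma agree_refl [simp]: "agree len g xs xs"
  by (simp add: agree_def)

lemma agree_0 [simp]: "agree len 0 xs ys"
  by (simp add: agree_def)

lemma agree_coords: "coords len 0 g xs = coords len 0 g ys \<Longrightarrow> agree len g xs ys"
  using coords_eqD[of len 0 g xs ys] by (simp add: agree_def)

text \<open>The case \<open>t \<le> s\<close> is covered too: then \<open>t - s = 0\<close>, the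
  pattern is empty, and agreement on \<open>s\<close> levels suffices. This matches the positive
  part in the sum bounds.\<close>

lemma agree_extend:
  assumes "agree len s xs ys" "coords len s (t - s) xs = coords len s (t - s) ys"
  shows "agree len t xs ys"
  unfolding agree_def
proof (intro allI impI)
  fix \<tau> i assume \<tau>: "\<tau> < len" and i: "i < t"
  show "xs ! \<tau> $ i = ys ! \<tau> $ i"
  proof (cases "i < s")
    case True
    then show ?thesis using assms(1) \<tau> by (simp add: agree_def)
  next
    case False
    then show ?thesis using coords_eqD[OF assms(2) \<tau>, of "i - s"] i by simp
  qed
qed

lemma received_block_cong:
  assumes "xs1 \<in> blocks q len" "xs2 \<in> blocks q len" "ys1 \<in> blocks q len" "ys2 \<in> blocks q len"
    and "agree len (g i 1) xs1 ys1" "agree len (g i 2) xs2 ys2"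
  shows "received_block q g i xs1 xs2 = received_block q g i ys1 ys2"
proof (rule blocks_eqI)
  fix t k assume t: "t < len" and k: "k < q"
  have less: "k - (q - h) < h" if "q - h \<le> k" for h
    using that k by linarith
  show "received_block q g i xs1 xs2 ! t $ k = received_block q g i ys1 ys2 ! t $ k"
    using assms(5,6) t less
    by (simp add: received_block_entry[OF assms(1,2) t k] received_block_entry[OF assms(3,4) t k]
        agree_def del: add_bit_eq_xor)
qed (intro received_block_in_blocks assms)+

text \<open>The common first input contributes equally to both sides and cancels; entry
  \<open>j\<close> of the second input is then read off in row \<open>q - g i 2 + j\<close>.\<close>

lemma received_block_cancel:
  assumes "xs1 \<in> blocks q len" "xs2 \<in> blocks q len" "ys2 \<in> blocks q len" "g i 2 \<le> q"
    and "received_block q g i xs1 xs2 = received_block q g i xs1 ys2"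
  shows "agree len (g i 2) xs2 ys2"
  unfolding agree_def
proof (intro allI impI)
  fix t j assume t: "t < len" and j: "j < g i 2"
  then have k: "q - g i 2 + j < q" using assms(4) by simp
  have "received_block q g i xs1 xs2 ! t $ (q - g i 2 + j) =
      received_block q g i xs1 ys2 ! t $ (q - g i 2 + j)"
    using assms(5) by simp
  then show "xs2 ! t $ j = ys2 ! t $ j"
    by (simp add: received_block_entry[OF assms(1,2) t k] received_block_entry[OF assms(1,3) t k]
        del: add_bit_eq_xor)
qed

text \<open>No link reaches the rows above the last \<open>M\<close>, so these are zero on both
  sides.\<close>

lemma received_block_eqI:
  assumes "xs1 \<in> blocks q len" "xs2 \<in> blocks q len" "ys1 \<in> blocks q len" "ys2 \<in> blocks q len"
    and "g i 1 \<le> q" "g i 2 \<le> q" and M: "M = max (g i 1) (g i 2)"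
    and eq: "coords len (q - M) M (received_block q g i xs1 xs2) =
      coords len (q - M) M (received_block q g i ys1 ys2)"
  shows "received_block q g i xs1 xs2 = received_block q g i ys1 ys2"
proof (rule blocks_eqI)
  fix t k assume t: "t < len" and k: "k < q"
  show "received_block q g i xs1 xs2 ! t $ k = received_block q g i ys1 ys2 ! t $ k"
  proof (cases "q - M \<le> k")
    case True
    moreover have "k - (q - M) < M" using True k by linarith
    ultimately show ?thesis using coords_eqD[OF eq t, of "k - (q - M)"] by simp
  next
    case False
    then have "\<not> q - g i 1 \<le> k" "\<not> q - g i 2 \<le> k" by (auto simp: M)
    then show ?thesis
      by (simp add: received_block_entry[OF assms(1,2) t k] received_block_entry[OF assms(3,4) t k])
  qed
qed (intro received_block_in_blocks assms)+

text \<open>This is the counting form of a genie argument: \<open>\<phi>\<close> is the observation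
  of the genie-aided receiver, and it has to determine the message pair.\<close>

lemma card_le_card_target:
  assumes "\<And>w. w \<in> D \<Longrightarrow> \<phi> w \<in> T" "finite T"
    and "\<And>w w'. w \<in> D \<Longrightarrow> w' \<in> D \<Longrightarrow> \<phi> w = \<phi> w' \<Longrightarrow> fst w = fst w' \<and> snd w = snd w'"
  shows "card D \<le> card T"
proof (rule card_inj_on_le)
  show "inj_on \<phi> D" using assms(3) by (intro inj_onI prod_eqI) blast+
qed (use assms(1,2) in auto)

text \<open>For each bound an observation is given that determines a correctly decoded pair. For the
  four single bounds it consists of one message and the levels sent over a direct link on the path
  of the other message; for the sums it is the genie-aided observation.\<close>

lemma code_cardinality_bounds:
  assumes gains: "\<forall>i\<in>{1, 2}. \<forall>j\<in>{1, 2}. m i j \<le> q \<and> n i j \<le> q"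
    and m21: "m 2 1 = 0" and n21: "n 2 1 = 0" and code: "is_code q len C"
  defines "G \<equiv> card (decoded_pairs q m n C)"
  shows "G \<le> 2 ^ (len * m 1 1) * card (messages C 2)"
    and "G \<le> 2 ^ (len * n 1 1) * card (messages C 2)"
    and "G \<le> 2 ^ (len * m 2 2) * card (messages C 1)"
    and "G \<le> 2 ^ (len * n 2 2) * card (messages C 1)"
    and "G \<le> 2 ^ (len * (max (m 1 1) (m 1 2) + (m 2 2 - m 1 2) + n 1 2))"
    and "G \<le> 2 ^ (len * (max (n 1 1) (n 1 2) + (n 2 2 - n 1 2) + m 1 2))"
proof -
  define D where "D = decoded_pairs q m n C"
  \<comment> \<open>The letters \<open>x\<close>, \<open>y\<close>, \<open>u\<close>,
    \<open>z\<close> stand for the signals sent by the sources, received by the relays, sent by the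
    relays and received by the destinations.\<close>
  define x1 x2 where "x1 w = encoder C 1 (fst w)" and "x2 w = encoder C 2 (snd w)"
    for w :: "nat \<times> nat"
  define y1 y2 where "y1 w = received_block q m 1 (x1 w) (x2 w)"
    and "y2 w = received_block q m 2 (x1 w) (x2 w)" for w
  define u1 u2 where "u1 w = relay C 1 (y1 w)" and "u2 w = relay C 2 (y2 w)" for w
  define z1 z2 where "z1 w = received_block q n 1 (u1 w) (u2 w)"
    and "z2 w = received_block q n 2 (u1 w) (u2 w)" for w
  have M: "finite (messages C 1)" "finite (messages C 2)"
    using code by (simp_all add: is_code_def)
  have maps: "encoder C i \<in> messages C i \<rightarrow> blocks q len" "relay C i \<in> blocks q len \<rightarrow> blocks q len"
    if "i \<in> {1, 2}" for i
    using code that by (auto simp: is_code_def)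
  have D: "fst w \<in> messages C 1" "snd w \<in> messages C 2"
    "decoder C 1 (z1 w) = fst w" "decoder C 2 (z2 w) = snd w" if "w \<in> D" for w
    using that by (auto simp: D_def decoded_pairs_def decoded_def destination_input_def
        relay_input_def x1_def x2_def y1_def y2_def u1_def u2_def z1_def z2_def prod_eq_iff)
  have x: "x1 w \<in> blocks q len" "x2 w \<in> blocks q len" if "w \<in> D" for w
    using D(1,2)[OF that] maps(1) by (auto simp: x1_def x2_def)
  have y: "y1 w \<in> blocks q len" "y2 w \<in> blocks q len" if "w \<in> D" for w
    unfolding y1_def y2_def by (intro received_block_in_blocks x that)+
  have u: "u1 w \<in> blocks q len" "u2 w \<in> blocks q len" if "w \<in> D" for w
    using y[OF that] maps(2) by (auto simp: u1_def u2_def)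
  have fin: "finite D"
    using M by (auto simp: D_def decoded_pairs_def)
  have y1I: "y1 w = y1 w'"
    if "agree len (m 1 1) (x1 w) (x1 w')" "agree len (m 1 2) (x2 w) (x2 w')" "w \<in> D" "w' \<in> D" for w w'
    unfolding y1_def by (intro received_block_cong[where len = len] x that)
  have y2I: "y2 w = y2 w'" if "agree len (m 2 2) (x2 w) (x2 w')" "w \<in> D" "w' \<in> D" for w w'
    unfolding y2_def by (intro received_block_cong[where len = len] x that) (simp add: m21[simplified])
  have z1I: "z1 w = z1 w'"
    if "agree len (n 1 1) (u1 w) (u1 w')" "agree len (n 1 2) (u2 w) (u2 w')" "w \<in> D" "w' \<in> D" for w w'
    unfolding z1_def by (intro received_block_cong[where len = len] u that)
  have z2I: "z2 w = z2 w'" if "agree len (n 2 2) (u2 w) (u2 w')" "w \<in> D" "w' \<in> D" for w w'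
    unfolding z2_def by (intro received_block_cong[where len = len] u that) (simp add: n21[simplified])
  have fstI: "fst w = fst w'" if "z1 w = z1 w'" "w \<in> D" "w' \<in> D" for w w'
    using D(3)[OF that(2)] D(3)[OF that(3)] that(1) by simp
  have sndI: "snd w = snd w'" if "z2 w = z2 w'" "w \<in> D" "w' \<in> D" for w w'
    using D(4)[OF that(2)] D(4)[OF that(3)] that(1) by simp
  have x1_cong: "x1 w = x1 w'" if "fst w = fst w'" for w w' using that by (simp add: x1_def)
  have x2_cong: "x2 w = x2 w'" if "snd w = snd w'" for w w' using that by (simp add: x2_def)
  have u1_cong: "u1 w = u1 w'" if "y1 w = y1 w'" for w w' using that by (simp add: u1_def)
  have u2_cong: "u2 w = u2 w'" if "y2 w = y2 w'" for w w' using that by (simp add: u2_def)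
  note G = card_le_card_target[of D, folded G_def[folded D_def]]
  show "G \<le> 2 ^ (len * m 1 1) * card (messages C 2)"
  proof -
    have "G \<le> card (patterns len (m 1 1) \<times> messages C 2)"
    proof (rule G[where \<phi> = "\<lambda>w. (coords len 0 (m 1 1) (x1 w), snd w)"])
      fix w w' assume w: "w \<in> D" "w' \<in> D"
        and "(coords len 0 (m 1 1) (x1 w), snd w) = (coords len 0 (m 1 1) (x1 w'), snd w')"
      then have x1: "agree len (m 1 1) (x1 w) (x1 w')" and snd: "snd w = snd w'"
        by (auto intro: agree_coords)
      note x2 = x2_cong[OF snd]
      have "u1 w = u1 w'" by (intro u1_cong y1I w x1) (simp add: x2)
      moreover have "u2 w = u2 w'" by (intro u2_cong y2I w) (simp add: x2)
      ultimately have "z1 w = z1 w'" by (intro z1I w) simp_all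
      with snd show "fst w = fst w' \<and> snd w = snd w'" using fstI w by blast
    qed (use D M in auto)
    then show ?thesis by (simp add: card_cartesian_product card_patterns)
  qed
  show "G \<le> 2 ^ (len * n 1 1) * card (messages C 2)"
  proof -
    have "G \<le> card (patterns len (n 1 1) \<times> messages C 2)"
    proof (rule G[where \<phi> = "\<lambda>w. (coords len 0 (n 1 1) (u1 w), snd w)"])
      fix w w' assume w: "w \<in> D" "w' \<in> D"
        and "(coords len 0 (n 1 1) (u1 w), snd w) = (coords len 0 (n 1 1) (u1 w'), snd w')"
      then have u1: "agree len (n 1 1) (u1 w) (u1 w')" and snd: "snd w = snd w'"
        by (auto intro: agree_coords)
      have "u2 w = u2 w'"
        by (intro u2_cong y2I w) (simp add: x2_cong[OF snd])
      then have "z1 w = z1 w'" by (intro z1I w u1) simp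
      with snd show "fst w = fst w' \<and> snd w = snd w'" using fstI w by blast
    qed (use D M in auto)
    then show ?thesis by (simp add: card_cartesian_product card_patterns)
  qed
  show "G \<le> 2 ^ (len * m 2 2) * card (messages C 1)"
  proof -
    have "G \<le> card (patterns len (m 2 2) \<times> messages C 1)"
    proof (rule G[where \<phi> = "\<lambda>w. (coords len 0 (m 2 2) (x2 w), fst w)"])
      fix w w' assume w: "w \<in> D" "w' \<in> D"
        and "(coords len 0 (m 2 2) (x2 w), fst w) = (coords len 0 (m 2 2) (x2 w'), fst w')"
      then have x2: "agree len (m 2 2) (x2 w) (x2 w')" and fst: "fst w = fst w'"
        by (auto intro: agree_coords)
      have "u2 w = u2 w'" by (intro u2_cong y2I w x2)
      then have "z2 w = z2 w'" by (intro z2I w) simp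
      with fst show "fst w = fst w' \<and> snd w = snd w'" using sndI w by blast
    qed (use D M in auto)
    then show ?thesis by (simp add: card_cartesian_product card_patterns)
  qed
  show "G \<le> 2 ^ (len * n 2 2) * card (messages C 1)"
  proof -
    have "G \<le> card (patterns len (n 2 2) \<times> messages C 1)"
    proof (rule G[where \<phi> = "\<lambda>w. (coords len 0 (n 2 2) (u2 w), fst w)"])
      fix w w' assume w: "w \<in> D" "w' \<in> D"
        and "(coords len 0 (n 2 2) (u2 w), fst w) = (coords len 0 (n 2 2) (u2 w'), fst w')"
      then have u2: "agree len (n 2 2) (u2 w) (u2 w')" and fst: "fst w = fst w'"
        by (auto intro: agree_coords)
      have "z2 w = z2 w'" by (intro z2I w u2)
      with fst show "fst w = fst w' \<and> snd w = snd w'" using sndI w by blast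
    qed (use D M in auto)
    then show ?thesis by (simp add: card_cartesian_product card_patterns)
  qed
  show "G \<le> 2 ^ (len * (max (m 1 1) (m 1 2) + (m 2 2 - m 1 2) + n 1 2))"
  proof -
    define A where "A = max (m 1 1) (m 1 2)"
    have "G \<le> card (patterns len A \<times> patterns len (m 2 2 - m 1 2) \<times> patterns len (n 1 2))"
    proof (rule G[where \<phi> = "\<lambda>w. (coords len (q - A) A (y1 w), coords len (m 1 2) (m 2 2 - m 1 2) (x2 w),
        coords len 0 (n 1 2) (u2 w))"])
      fix w w' assume w: "w \<in> D" "w' \<in> D"
        and "(coords len (q - A) A (y1 w), coords len (m 1 2) (m 2 2 - m 1 2) (x2 w),
            coords len 0 (n 1 2) (u2 w)) =
          (coords len (q - A) A (y1 w'), coords len (m 1 2) (m 2 2 - m 1 2) (x2 w'),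
            coords len 0 (n 1 2) (u2 w'))"
      then have c: "coords len (q - A) A (y1 w) = coords len (q - A) A (y1 w')"
        and low: "coords len (m 1 2) (m 2 2 - m 1 2) (x2 w) = coords len (m 1 2) (m 2 2 - m 1 2) (x2 w')"
        and u2: "agree len (n 1 2) (u2 w) (u2 w')"
        by (auto intro: agree_coords)
      have y1: "y1 w = y1 w'"
        using c gains unfolding y1_def
        by (intro received_block_eqI[where M = A and len = len] x w) (simp_all add: A_def)
      then have "z1 w = z1 w'" by (intro z1I w u2) (simp add: u1_cong[OF y1])
      then have fst: "fst w = fst w'" by (intro fstI w)
      have "agree len (m 1 2) (x2 w) (x2 w')"
        using y1 gains unfolding y1_def x1_cong[OF fst]
        by (intro received_block_cancel[where ?xs1.0 = "x1 w'" and q = q and g = m and i = 1] x w) simp_all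
      then have "agree len (m 2 2) (x2 w) (x2 w')" by (rule agree_extend[OF _ low])
      then have "u2 w = u2 w'" by (intro u2_cong y2I w)
      then have "z2 w = z2 w'" by (intro z2I w) simp
      with fst show "fst w = fst w' \<and> snd w = snd w'" using sndI w by blast
    qed simp_all
    then show ?thesis
      by (simp add: card_cartesian_product card_patterns A_def power_add algebra_simps)
  qed
  show "G \<le> 2 ^ (len * (max (n 1 1) (n 1 2) + (n 2 2 - n 1 2) + m 1 2))"
  proof -
    define A where "A = max (n 1 1) (n 1 2)"
    have "G \<le> card (patterns len A \<times> patterns len (n 2 2 - n 1 2) \<times> patterns len (m 1 2))"
    proof (rule G[where \<phi> = "\<lambda>w. (coords len (q - A) A (z1 w), coords len (n 1 2) (n 2 2 - n 1 2) (u2 w),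
        coords len 0 (m 1 2) (x2 w))"])
      fix w w' assume w: "w \<in> D" "w' \<in> D"
        and "(coords len (q - A) A (z1 w), coords len (n 1 2) (n 2 2 - n 1 2) (u2 w),
            coords len 0 (m 1 2) (x2 w)) =
          (coords len (q - A) A (z1 w'), coords len (n 1 2) (n 2 2 - n 1 2) (u2 w'),
            coords len 0 (m 1 2) (x2 w'))"
      then have c: "coords len (q - A) A (z1 w) = coords len (q - A) A (z1 w')"
        and low: "coords len (n 1 2) (n 2 2 - n 1 2) (u2 w) = coords len (n 1 2) (n 2 2 - n 1 2) (u2 w')"
        and x2: "agree len (m 1 2) (x2 w) (x2 w')"
        by (auto intro: agree_coords)
      \<comment> \<open>Unlike in the first sum bound, decoding comes first: \<open>z1\<close> alone
        yields the first message, which together with the audible part of \<open>x2\<close> gives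
        \<open>y1\<close> and \<open>u1\<close>. Only then can \<open>u1\<close> be cancelled from
        \<open>z1\<close>.\<close>
      have z1: "z1 w = z1 w'"
        using c gains unfolding z1_def
        by (intro received_block_eqI[where M = A and len = len] u w) (simp_all add: A_def)
      then have fst: "fst w = fst w'" by (intro fstI w)
      have "y1 w = y1 w'" by (intro y1I w x2) (simp add: x1_cong[OF fst])
      note u1 = u1_cong[OF this]
      have "agree len (n 1 2) (u2 w) (u2 w')"
        using z1 gains unfolding z1_def u1
        by (intro received_block_cancel[where ?xs1.0 = "u1 w'" and q = q and g = n and i = 1] u w) simp_all
      then have "agree len (n 2 2) (u2 w) (u2 w')" by (rule agree_extend[OF _ low])
      then have "z2 w = z2 w'" by (intro z2I w)
      with fst show "fst w = fst w' \<and> snd w = snd w'" using sndI w by blast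
    qed simp_all
    then show ?thesis
      by (simp add: card_cartesian_product card_patterns A_def power_add algebra_simps)
  qed
qed

section \<open>From cardinalities to rates\<close>

text \<open>If \<open>r\<close> exceeded \<open>B\<close>, the left side would outgrow the right one
  exponentially, and the factor \<open>1 - \<epsilon>\<close> could not prevent it. The loss
  \<open>2 * \<epsilon>\<close> is that of a sum of two rates; a single rate loses only
  \<open>\<epsilon>\<close> and satisfies this weaker form as well.\<close>

lemma rate_le_exponent:
  fixes r B :: real
  assumes "\<And>\<epsilon>. 0 < \<epsilon> \<Longrightarrow> \<epsilon> < 1 \<Longrightarrow>
    \<forall>\<^sub>F len in sequentially. (1 - \<epsilon>) * 2 powr (real len * (r - 2 * \<epsilon>)) \<le> 2 powr (real len * B)"
  shows "r \<le> B"
proof (rule ccontr)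
  assume "\<not> r \<le> B"
  \<comment> \<open>The first bound keeps \<open>1 - \<epsilon>\<close> at least
    \<open>1 / 2\<close>; the second one leaves an excess \<open>\<delta>\<close> of at least half
    of \<open>r - B\<close>.\<close>
  define \<epsilon> where "\<epsilon> = min (1 / 2) ((r - B) / 4)"
  define \<delta> where "\<delta> = r - 2 * \<epsilon> - B"
  have \<epsilon>: "0 < \<epsilon>" "\<epsilon> < 1" "1 / 2 \<le> 1 - \<epsilon>" and \<delta>: "0 < \<delta>"
    using \<open>\<not> r \<le> B\<close> by (auto simp: \<epsilon>_def \<delta>_def min_def field_simps)
  have "filterlim (\<lambda>len. real len * \<delta>) at_top sequentially"
    using \<delta> by (intro filterlim_at_top_mult_tendsto_pos[OF tendsto_const] filterlim_real_sequentially)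
  then have "\<forall>\<^sub>F len in sequentially. 1 < real len * \<delta>"
    by (simp add: filterlim_at_top_dense)
  with assms[OF \<epsilon>(1,2)]
  have "\<forall>\<^sub>F len in sequentially. False"
  proof eventually_elim
    case (elim len)
    have "2 powr (real len * B) < (1 / 2) * 2 powr (real len * \<delta> + real len * B)"
    proof -
      have "2 powr 1 < 2 powr (real len * \<delta>)" using elim(2) by (intro powr_less_mono) auto
      then show ?thesis by (simp add: powr_add)
    qed
    also have "\<dots> \<le> (1 - \<epsilon>) * 2 powr (real len * (r - 2 * \<epsilon>))"
      using \<epsilon>(3) by (intro mult_mono) (simp_all add: \<delta>_def algebra_simps)
    finally show False using elim(1) by simp
  qed
  then show False by simp
qed

lemma converse:
  assumes gains: "\<forall>i\<in>{1, 2}. \<forall>j\<in>{1, 2}. m i j \<le> q \<and> n i j \<le> q"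
    and "m 2 1 = 0" "n 2 1 = 0" and adm: "admissible q m n r1 r2"
  shows "r1 \<le> m 1 1" "r1 \<le> n 1 1" "r2 \<le> m 2 2" "r2 \<le> n 2 2"
    "r1 + r2 \<le> real (max (m 1 1) (m 1 2) + (m 2 2 - m 1 2) + n 1 2)"
    "r1 + r2 \<le> real (max (n 1 1) (n 1 2) + (n 2 2 - n 1 2) + m 1 2)"
proof -
  have limit: "r \<le> real B"
    if bound: "\<And>len C \<epsilon>. is_code q len C \<Longrightarrow> 0 < \<epsilon> \<Longrightarrow> \<epsilon> < 1 \<Longrightarrow>
      2 powr (real len * (r1 - \<epsilon>)) \<le> card (messages C 1) \<Longrightarrow>
      2 powr (real len * (r2 - \<epsilon>)) \<le> card (messages C 2) \<Longrightarrow>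
      (1 - \<epsilon>) * (card (messages C 1) * card (messages C 2)) \<le> card (decoded_pairs q m n C) \<Longrightarrow>
      (1 - \<epsilon>) * 2 powr (real len * (r - 2 * \<epsilon>)) \<le> 2 ^ (len * B)" for r and B :: nat
  proof (rule rate_le_exponent)
    fix \<epsilon> :: real assume \<epsilon>: "0 < \<epsilon>" "\<epsilon> < 1"
    with adm have "\<forall>\<^sub>F len in sequentially. \<exists>C. is_code q len C \<and>
        real (card (messages C 1)) \<ge> 2 powr (real len * (r1 - \<epsilon>)) \<and>
        real (card (messages C 2)) \<ge> 2 powr (real len * (r2 - \<epsilon>)) \<and>
        error_prob q m n C \<le> \<epsilon>"
      unfolding admissible_def by blast
    then show "\<forall>\<^sub>F len in sequentially.
        (1 - \<epsilon>) * 2 powr (real len * (r - 2 * \<epsilon>)) \<le> 2 powr (real len * real B)"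
    proof eventually_elim
      case (elim len)
      then obtain C where C: "is_code q len C"
        "2 powr (real len * (r1 - \<epsilon>)) \<le> card (messages C 1)"
        "2 powr (real len * (r2 - \<epsilon>)) \<le> card (messages C 2)" "error_prob q m n C \<le> \<epsilon>"
        by blast
      have "(1 - \<epsilon>) * (card (messages C 1) * card (messages C 2)) \<le> card (decoded_pairs q m n C)"
        unfolding card_decoded_pairs[OF C(1)] using C(4) by (intro mult_right_mono) auto
      from bound[OF C(1) \<epsilon> C(2,3) this] show ?case
        by (simp add: powr_realpow flip: of_nat_mult)
    qed
  qed
  note bounds = code_cardinality_bounds[OF assms(1-3)]
  \<comment> \<open>The size \<open>K'\<close> of the other message set occurs on both sides and
    cancels, being positive.\<close>
  have single: "(1 - \<epsilon>) * 2 powr (real len * (r - 2 * \<epsilon>)) \<le> 2 ^ (len * B)"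
    if "0 < \<epsilon>" "\<epsilon> < 1" "2 powr (real len * (r - \<epsilon>)) \<le> real K" "0 < K'"
      "(1 - \<epsilon>) * (K * K') \<le> real c" "c \<le> 2 ^ (len * B) * K'" for \<epsilon> r and len B K K' c :: nat
  proof -
    have "real c \<le> 2 ^ (len * B) * real K'" using of_nat_mono[OF that(6), where 'a = real] by simp
    with that(5) have "((1 - \<epsilon>) * real K) * real K' \<le> 2 ^ (len * B) * real K'"
      by (simp add: mult.assoc)
    then have "(1 - \<epsilon>) * real K \<le> 2 ^ (len * B)" using that(4) by simp
    moreover have "2 powr (real len * (r - 2 * \<epsilon>)) \<le> 2 powr (real len * (r - \<epsilon>))"
      using that(1) by (intro powr_mono mult_left_mono) auto
    then have "(1 - \<epsilon>) * 2 powr (real len * (r - 2 * \<epsilon>)) \<le> (1 - \<epsilon>) * real K"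
      using that(2,3) by (intro mult_left_mono order.trans[OF _ that(3)]) simp_all
    ultimately show ?thesis by linarith
  qed
  have sum: "(1 - \<epsilon>) * 2 powr (real len * (r1 + r2 - 2 * \<epsilon>)) \<le> 2 ^ (len * B)"
    if "0 < \<epsilon>" "\<epsilon> < 1" "2 powr (real len * (r1 - \<epsilon>)) \<le> real K" "2 powr (real len * (r2 - \<epsilon>)) \<le> real K'"
      "(1 - \<epsilon>) * (K * K') \<le> real c" "c \<le> 2 ^ (len * B)" for \<epsilon> and len B K K' c :: nat
  proof -
    have "2 powr (real len * (r1 + r2 - 2 * \<epsilon>)) =
        2 powr (real len * (r1 - \<epsilon>)) * 2 powr (real len * (r2 - \<epsilon>))"
      by (simp add: algebra_simps flip: powr_add)
    also have "\<dots> \<le> real K * real K'" using that(3,4) by (intro mult_mono) auto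
    finally have "(1 - \<epsilon>) * 2 powr (real len * (r1 + r2 - 2 * \<epsilon>)) \<le> (1 - \<epsilon>) * (K * K')"
      using that(2) by (intro mult_left_mono) auto
    also have "\<dots> \<le> 2 ^ (len * B)"
    proof -
      have "real c \<le> 2 ^ (len * B)" using that(6) by simp
      with that(5) show ?thesis by (simp only: of_nat_mult)
    qed
    finally show ?thesis .
  qed
  have pos: "0 < card (messages C 1)" "0 < card (messages C 2)" if "is_code q len C" for len C
    using that by (auto simp: is_code_def card_gt_0_iff)
  have swap: "(1 - \<epsilon>) * (K' * K) \<le> real c" if "(1 - \<epsilon>) * (K * K') \<le> real c" for \<epsilon> :: real and K K' c :: nat
    using that by (simp add: mult.commute)
  show "r1 \<le> m 1 1" by (rule limit) (rule single[OF _ _ _ pos(2) _ bounds(1)])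
  show "r1 \<le> n 1 1" by (rule limit) (rule single[OF _ _ _ pos(2) _ bounds(2)])
  show "r2 \<le> m 2 2" by (rule limit) (rule single[OF _ _ _ pos(1) swap bounds(3)])
  show "r2 \<le> n 2 2" by (rule limit) (rule single[OF _ _ _ pos(1) swap bounds(4)])
  show "r1 + r2 \<le> real (max (m 1 1) (m 1 2) + (m 2 2 - m 1 2) + n 1 2)"
    by (rule limit) (rule sum[OF _ _ _ _ _ bounds(5)])
  show "r1 + r2 \<le> real (max (n 1 1) (n 1 2) + (n 2 2 - n 1 2) + m 1 2)"
    by (rule limit) (rule sum[OF _ _ _ _ _ bounds(6)])
qed

theorem theorem2:
  fixes q :: nat and m n :: "nat \<Rightarrow> nat \<Rightarrow> nat"
  assumes "q \<ge> 1"
    and "\<forall>i\<in>{1, 2}. \<forall>j\<in>{1, 2}. m i j \<le> q \<and> n i j \<le> q"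
    and "m 2 1 = 0" and "n 2 1 = 0"
  shows "capacity_region q m n =
    {(r1, r2). 0 \<le> r1 \<and> 0 \<le> r2 \<and>
       r1 \<le> real (m 1 1) \<and> r2 \<le> real (m 2 2) \<and>
       r1 \<le> real (n 1 1) \<and> r2 \<le> real (n 2 2) \<and>
       r1 + r2 \<le> max (real (m 1 1)) (real (m 1 2)) + max (real (m 2 2) - real (m 1 2)) 0 + real (n 1 2) \<and>
       r1 + r2 \<le> max (real (n 1 1)) (real (n 1 2)) + max (real (n 2 2) - real (n 1 2)) 0 + real (m 1 2)}"
proof -
  \<comment> \<open>Truncated subtraction of naturals becomes the positive part over the
    reals.\<close>
  have sum_eq: "real (max a b + (c - b) + d) = max (real a) (real b) + max (real c - real b) 0 + real d"
    for a b c d :: nat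
    by (simp add: of_nat_diff max_def)
  have "admissible q m n r1 r2 \<longleftrightarrow> 0 \<le> r1 \<and> 0 \<le> r2 \<and>
       r1 \<le> real (m 1 1) \<and> r2 \<le> real (m 2 2) \<and> r1 \<le> real (n 1 1) \<and> r2 \<le> real (n 2 2) \<and>
       r1 + r2 \<le> real (max (m 1 1) (m 1 2) + (m 2 2 - m 1 2) + n 1 2) \<and>
       r1 + r2 \<le> real (max (n 1 1) (n 1 2) + (n 2 2 - n 1 2) + m 1 2)" (is "_ \<longleftrightarrow> ?R r1 r2")
    for r1 r2
  proof
    assume adm: "admissible q m n r1 r2"
    then have "0 \<le> r1" "0 \<le> r2" by (simp_all add: admissible_def)
    with converse[OF assms(2-4) adm] show "?R r1 r2" by blast
  qed (use achievability[OF assms(2-4)] in blast)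
  then show ?thesis
    unfolding capacity_region_def sum_eq by auto
qed

end
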